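(* Let $I$ be a totally ordered set with a greatest element $i_0$, let $A$ be a Banach algebra with a left identity, and let $\phi\in\Delta(A)$. Let $\psi_\phi\in\Delta(UP_I(A))$ be given by $\psi_\phi((a_{i,j})_{i,j\in I})=\phi(a_{i_0,i_0})$. Then $UP_I(A)^{**}$ is left $\psi_\phi$-biflat (with $\psi_\phi$ extended to $UP_I(A)^{**}$) if and only if $|I|=1$ and $A$ is left $\phi$-biflat.
   Context: For a Banach algebra $A$, $\Delta(A)$ is the set of all non-zero multiplicative linear functionals on $A$. The bidual $A^{**}$ is a Banach algebra under the (first) Arens product, and $\phi\in\Delta(A)$ extends to $\tilde{\phi}\in\Delta(A^{**})$ by $\tilde{\phi}(F)=F(\phi)$. $UP_I(A)$ is the Banach algebra of $I\times I$ upper triangular matrices $(a_{i,j})_{i,j\in I}$ with entries in $A$ (so $a_{i,j}=0$ unless $i\le j$) and $\|(a_{i,j})\|=\sum_{i,j\in I}\|a_{i,j}\|<\infty$, with matrix operations. $A\otimes_pA$ is the projective tensor product, a Banach $A$-bimodule via $a\cdot(b\otimes c)=ab\otimes c$, $(b\otimes c)\cdot a=b\otimes ca$; $\pi_A:A\otimes_pA\to A$ is the bounded linear map with $\pi_A(a\otimes b)=ab$. For a Banach $A$-bimodule $X$, $X^*$ is a Banach $A$-bimodule via $(a\cdot f)(x)=f(x\cdot a)$, $(f\cdot a)(x)=f(a\cdot x)$; iterating, $(A\otimes_pA)^{**}$ is a Banach $A$-bimodule. For $\phi\in\Delta(A)$, $A$ is left $\phi$-biflat if there is a bounded linear map $\rho:A\to(A\otimes_pA)^{**}$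 with $\rho(ab)=\phi(b)\rho(a)=a\cdot\rho(b)$ and $\tilde{\phi}\circ\pi_A^{**}\circ\rho(a)=\phi(a)$ for all $a,b\in A$. For $UP_I(A)^{**}$ this definition is applied to the Banach algebra $UP_I(A)^{**}$ and the character $\widetilde{\psi_\phi}$. *)

theory Defs
  imports "HOL-Analysis.Analysis"
begin

section \<open>Complex Banach spaces and Banach algebras\<close>

class scaleC =
  fixes scaleC :: "complex \<Rightarrow> 'a \<Rightarrow> 'a" (infixr "*\<^sub>C" 75)

class complex_normed_vector = real_normed_vector + scaleC +
  assumes scaleC_add_right: "c *\<^sub>C (x + y) = c *\<^sub>C x + c *\<^sub>C y"
    and scaleC_add_left: "(c + d) *\<^sub>C x = c *\<^sub>C x + d *\<^sub>C x"
    and scaleC_scaleC: "c *\<^sub>C (d *\<^sub>C x) = (c * d) *\<^sub>C x"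
    and scaleC_of_real: "complex_of_real r *\<^sub>C x = r *\<^sub>R x"
    and norm_scaleC: "norm (c *\<^sub>C x) = cmod c * norm x"

class complex_banach = complex_normed_vector + banach

text \<open>Banach algebras need not be unital.\<close>

class complex_banach_algebra = complex_banach + real_normed_algebra +
  assumes mult_scaleC_left: "(c *\<^sub>C x) * y = c *\<^sub>C (x * y)"
    and mult_scaleC_right: "x * (c *\<^sub>C y) = c *\<^sub>C (x * y)"

lemma scaleC_one [simp]: "1 *\<^sub>C (x::'a::complex_normed_vector) = x"
  using scaleC_of_real[of 1 x] by simp

lemma scaleC_zero_left [simp]: "0 *\<^sub>C (x::'a::complex_normed_vector) = 0"
  using scaleC_of_real[of 0 x] by simp

lemma scaleC_zero_right [simp]: "c *\<^sub>C (0::'a::complex_normed_vector) = 0"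
  using norm_scaleC[of c "0::'a"] by simp

lemma scaleC_minus_right: "c *\<^sub>C (- x) = - (c *\<^sub>C (x::'a::complex_normed_vector))"
  using scaleC_add_right[of c x "- x"] by (simp add: eq_neg_iff_add_eq_0 add.commute)

lemma scaleC_diff_right: "c *\<^sub>C (x - y) = c *\<^sub>C x - c *\<^sub>C (y::'a::complex_normed_vector)"
  using scaleC_add_right[of c x "- y"] by (simp add: scaleC_minus_right)

lemma scaleC_minus_left: "(- c) *\<^sub>C x = - (c *\<^sub>C (x::'a::complex_normed_vector))"
  using scaleC_add_left[of c "- c" x] by (simp add: eq_neg_iff_add_eq_0 add.commute)

lemma scaleR_scaleC: "r *\<^sub>R x = complex_of_real r *\<^sub>C (x::'a::complex_normed_vector)"
  by (simp add: scaleC_of_real)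

lemma bounded_linear_scaleC: "bounded_linear (\<lambda>x::'a::complex_normed_vector. c *\<^sub>C x)"
  by (rule bounded_linear_intro[where K="cmod c"])
     (auto simp: scaleC_add_right scaleR_scaleC scaleC_scaleC norm_scaleC mult.commute)

instantiation complex :: complex_banach_algebra
begin
definition scaleC_complex :: "complex \<Rightarrow> complex \<Rightarrow> complex"
  where "scaleC_complex c x = c * x"
instance
  by standard (auto simp: scaleC_complex_def algebra_simps scaleR_conv_of_real norm_mult)
end

lemma scaleC_complex [simp]: "c *\<^sub>C (x::complex) = c * x"
  by (simp add: scaleC_complex_def)

text \<open>A norm-preserving additive map onto a closed subset of a Banach space has complete domain.\<close>

lemma convergent_if_closed_range:
  fixes R :: "'b::real_normed_vector \<Rightarrow> 'c::banach"
  assumes "\<And>x y. R (x - y) = R x - R y" and "\<And>x. norm (R x) = norm x"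
    and "closed (range R)" and "Cauchy (X :: nat \<Rightarrow> 'b)"
  shows "convergent X"
proof -
  have d: "dist (R x) (R y) = dist x y" for x y
    by (simp add: dist_norm assms(1)[symmetric] assms(2))
  have "Cauchy (\<lambda>n. R (X n))"
    using \<open>Cauchy X\<close> unfolding Cauchy_def d .
  then obtain l where l: "(\<lambda>n. R (X n)) \<longlonglongrightarrow> l"
    by (auto simp: Cauchy_convergent_iff convergent_def)
  have "l \<in> range R"
    by (rule closed_sequentially[OF assms(3) _ l]) simp
  then obtain x where "l = R x" by auto
  with l have "X \<longlonglongrightarrow> x"
    unfolding tendsto_iff by (simp add: d)
  then show ?thesis by (auto simp: convergent_def)
qed

section \<open>Bounded complex-linear maps\<close>

definition bounded_clinear :: "('a::complex_normed_vector \<Rightarrow> 'b::complex_normed_vector) \<Rightarrow> bool"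
  where "bounded_clinear f \<longleftrightarrow> bounded_linear f \<and> (\<forall>c x. f (c *\<^sub>C x) = c *\<^sub>C f x)"

lemma bounded_clinearI:
  assumes "\<And>x y. f (x + y) = f x + f y" and "\<And>c x. f (c *\<^sub>C x) = c *\<^sub>C f x"
    and "\<And>x. norm (f x) \<le> K * norm x"
  shows "bounded_clinear f"
  unfolding bounded_clinear_def
  by (auto intro!: bounded_linear_intro[where K=K] simp: assms scaleR_scaleC mult.commute)

lemma bounded_clinearD: "bounded_clinear f \<Longrightarrow> bounded_linear f"
  by (simp add: bounded_clinear_def)

typedef (overloaded) ('a, 'b) cblinfun ("(_ \<rightarrow>\<^sub>C /_)" [22, 21] 21) =
  "{f::'a::complex_normed_vector \<Rightarrow> 'b::complex_normed_vector. bounded_clinear f}"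
  morphisms cblinfun_apply CBlinfun
  by (rule exI[of _ "\<lambda>_. 0"]) (simp add: bounded_clinear_def)

declare [[coercion
  "cblinfun_apply :: ('a::complex_normed_vector \<rightarrow>\<^sub>C 'b::complex_normed_vector) \<Rightarrow> 'a \<Rightarrow> 'b"]]

setup_lifting type_definition_cblinfun

instantiation cblinfun :: (complex_normed_vector, complex_normed_vector) complex_normed_vector
begin

lift_definition norm_cblinfun :: "('a \<rightarrow>\<^sub>C 'b) \<Rightarrow> real" is onorm .

lift_definition minus_cblinfun :: "('a \<rightarrow>\<^sub>C 'b) \<Rightarrow> ('a \<rightarrow>\<^sub>C 'b) \<Rightarrow> ('a \<rightarrow>\<^sub>C 'b)"
  is "\<lambda>f g x. f x - g x"
  by (auto simp: bounded_clinear_def bounded_linear_sub scaleC_diff_right)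

lift_definition uminus_cblinfun :: "('a \<rightarrow>\<^sub>C 'b) \<Rightarrow> ('a \<rightarrow>\<^sub>C 'b)"
  is "\<lambda>f x. - f x"
  by (auto simp: bounded_clinear_def bounded_linear_minus scaleC_minus_right)

lift_definition plus_cblinfun :: "('a \<rightarrow>\<^sub>C 'b) \<Rightarrow> ('a \<rightarrow>\<^sub>C 'b) \<Rightarrow> ('a \<rightarrow>\<^sub>C 'b)"
  is "\<lambda>f g x. f x + g x"
  by (auto simp: bounded_clinear_def bounded_linear_add scaleC_add_right)

lift_definition zero_cblinfun :: "'a \<rightarrow>\<^sub>C 'b" is "\<lambda>_. 0"
  by (simp add: bounded_clinear_def)

lift_definition scaleC_cblinfun :: "complex \<Rightarrow> ('a \<rightarrow>\<^sub>C 'b) \<Rightarrow> ('a \<rightarrow>\<^sub>C 'b)"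
  is "\<lambda>c f x. c *\<^sub>C f x"
  by (auto simp: bounded_clinear_def scaleC_scaleC mult.commute
      intro: bounded_linear_compose[OF bounded_linear_scaleC])

lift_definition scaleR_cblinfun :: "real \<Rightarrow> ('a \<rightarrow>\<^sub>C 'b) \<Rightarrow> ('a \<rightarrow>\<^sub>C 'b)"
  is "\<lambda>r f x. r *\<^sub>R f x"
  by (auto simp: bounded_clinear_def scaleR_scaleC scaleC_scaleC mult.commute
      intro: bounded_linear_compose[OF bounded_linear_scaleC])

definition dist_cblinfun :: "('a \<rightarrow>\<^sub>C 'b) \<Rightarrow> ('a \<rightarrow>\<^sub>C 'b) \<Rightarrow> real"
  where "dist_cblinfun f g = norm (f - g)"
definition sgn_cblinfun :: "('a \<rightarrow>\<^sub>C 'b) \<Rightarrow> ('a \<rightarrow>\<^sub>C 'b)"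
  where "sgn_cblinfun f = inverse (norm f) *\<^sub>R f"
definition uniformity_cblinfun :: "(('a \<rightarrow>\<^sub>C 'b) \<times> ('a \<rightarrow>\<^sub>C 'b)) filter"
  where [code del]: "uniformity_cblinfun = (INF e\<in>{0 <..}. principal {(x, y). dist x y < e})"
definition open_cblinfun :: "('a \<rightarrow>\<^sub>C 'b) set \<Rightarrow> bool"
  where [code del]: "open_cblinfun S = (\<forall>x\<in>S. \<forall>\<^sub>F (x', y) in uniformity. x' = x \<longrightarrow> y \<in> S)"

lemma onorm_scaleC:
  assumes "bounded_clinear f"
  shows "onorm (\<lambda>x. c *\<^sub>C f x) = cmod c * onorm f"
proof (cases "c = 0")
  case True then show ?thesis by (simp add: onorm_zero)
next
  case False
  have bl: "bounded_linear f" and bl2: "bounded_linear (\<lambda>x. c *\<^sub>C f x)"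
    using assms by (auto simp: bounded_clinear_def intro: bounded_linear_compose[OF bounded_linear_scaleC])
  have 1: "onorm (\<lambda>x. c *\<^sub>C f x) \<le> cmod c * onorm f"
    by (rule onorm_bound)
       (auto simp: norm_scaleC mult.assoc onorm_pos_le[OF bl] intro!: mult_left_mono onorm[OF bl])
  have "onorm f \<le> onorm (\<lambda>x. c *\<^sub>C f x) / cmod c"
  proof (rule onorm_bound)
    fix x
    show "norm (f x) \<le> onorm (\<lambda>x. c *\<^sub>C f x) / cmod c * norm x"
      using onorm[OF bl2, of x] False by (simp add: norm_scaleC field_simps)
  qed (simp add: onorm_pos_le[OF bl2])
  with 1 False show ?thesis by (simp add: field_simps)
qed

instance
proof
  fix f g h :: "'a \<rightarrow>\<^sub>C 'b" and r s :: real and c d :: complex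
  show "f + g + h = f + (g + h)" by transfer (simp add: add.assoc)
  show "f + g = g + f" by transfer (simp add: add.commute)
  show "0 + f = f" by transfer simp
  show "- f + f = 0" by transfer simp
  show "f - g = f + - g" by transfer simp
  show "r *\<^sub>R (f + g) = r *\<^sub>R f + r *\<^sub>R g" by transfer (simp add: algebra_simps)
  show "(r + s) *\<^sub>R f = r *\<^sub>R f + s *\<^sub>R f" by transfer (simp add: algebra_simps)
  show "r *\<^sub>R s *\<^sub>R f = (r * s) *\<^sub>R f" by transfer simp
  show "1 *\<^sub>R f = f" by transfer simp
  show "dist f g = norm (f - g)" by (simp add: dist_cblinfun_def)
  show "sgn f = inverse (norm f) *\<^sub>R f" by (simp add: sgn_cblinfun_def)
  show "uniformity = (INF e\<in>{0<..}. principal {(x::'a \<rightarrow>\<^sub>C 'b, y). dist x y < e})"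
    by (simp add: uniformity_cblinfun_def)
  show "open S = (\<forall>x\<in>S. \<forall>\<^sub>F (x', y) in uniformity. x' = x \<longrightarrow> y \<in> S)" for S :: "('a \<rightarrow>\<^sub>C 'b) set"
    by (simp add: open_cblinfun_def)
  show "(norm f = 0) = (f = 0)"
    by transfer (auto simp: onorm_eq_0 bounded_clinearD fun_eq_iff)
  show "norm (f + g) \<le> norm f + norm g"
    by transfer (simp add: onorm_triangle bounded_clinearD)
  show "norm (r *\<^sub>R f) = \<bar>r\<bar> * norm f"
    by transfer (simp add: onorm_scaleR bounded_clinearD)
  show "c *\<^sub>C (f + g) = c *\<^sub>C f + c *\<^sub>C g" by transfer (simp add: scaleC_add_right)
  show "(c + d) *\<^sub>C f = c *\<^sub>C f + d *\<^sub>C f" by transfer (simp add: scaleC_add_left)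
  show "c *\<^sub>C d *\<^sub>C f = (c * d) *\<^sub>C f" by transfer (simp add: scaleC_scaleC)
  show "complex_of_real r *\<^sub>C f = r *\<^sub>R f" by transfer (simp add: scaleC_of_real)
  show "norm (c *\<^sub>C f) = cmod c * norm f" by transfer (rule onorm_scaleC)
qed

end

lemma cblinfun_eqI: "(\<And>x. f x = g x) \<Longrightarrow> f = g" for f g :: "'a::complex_normed_vector \<rightarrow>\<^sub>C 'b::complex_normed_vector"
  by transfer auto

lemma cblinfun_simps [simp]:
  fixes f g :: "'a::complex_normed_vector \<rightarrow>\<^sub>C 'b::complex_normed_vector"
  shows "(f + g) x = f x + g x" "(f - g) x = f x - g x" "(- f) x = - f x"
    "(0::'a \<rightarrow>\<^sub>C 'b) x = 0" "(c *\<^sub>C f) x = c *\<^sub>C f x" "(r *\<^sub>R f) x = r *\<^sub>R f x"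
  by (transfer, simp)+

lemma bounded_clinear_cblinfun: "bounded_clinear (cblinfun_apply f)"
  using cblinfun_apply by blast

lemmas bounded_linear_cblinfun = bounded_clinear_cblinfun[THEN bounded_clinearD]

lemma cblinfun_linear:
  fixes f :: "'a::complex_normed_vector \<rightarrow>\<^sub>C 'b::complex_normed_vector"
  shows "f (x + y) = f x + f y" "f (x - y) = f x - f y" "f (- x) = - f x" "f 0 = 0"
    "f (c *\<^sub>C x) = c *\<^sub>C f x" "f (r *\<^sub>R x) = r *\<^sub>R f x"
  using bounded_linear_cblinfun[of f] bounded_clinear_cblinfun[of f]
  by (auto simp: linear_simps bounded_clinear_def)

lemma norm_cblinfun: "norm (f x) \<le> norm f * norm x"
  for f :: "'a::complex_normed_vector \<rightarrow>\<^sub>C 'b::complex_normed_vector"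
  by transfer (simp add: onorm bounded_clinearD)

lemma norm_cblinfun_bound:
  fixes f :: "'a::complex_normed_vector \<rightarrow>\<^sub>C 'b::complex_normed_vector"
  shows "0 \<le> b \<Longrightarrow> (\<And>x. norm (f x) \<le> b * norm x) \<Longrightarrow> norm f \<le> b"
  by transfer (rule onorm_bound)

lemma CBlinfun_apply:
  "bounded_clinear f \<Longrightarrow> cblinfun_apply (CBlinfun f) = f"
  by (simp add: CBlinfun_inverse)

lemma CBlinfun_apply':
  assumes "\<And>x y. f (x + y) = f x + f y" "\<And>c x. f (c *\<^sub>C x) = c *\<^sub>C f x"
    "\<And>x. norm (f x) \<le> K * norm x"
  shows "cblinfun_apply (CBlinfun f) = f"
  using bounded_clinearI[OF assms] by (rule CBlinfun_apply)

lemma norm_CBlinfun: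
  assumes "\<And>x y. f (x + y) = f x + f y" "\<And>c x. f (c *\<^sub>C x) = c *\<^sub>C f x"
    "\<And>x. norm (f x) \<le> K * norm x" "0 \<le> K"
  shows "norm (CBlinfun f) \<le> K"
  by (rule norm_cblinfun_bound) (auto simp: CBlinfun_apply'[OF assms(1,2,3)] assms)

instance cblinfun :: (complex_normed_vector, complex_banach) complex_banach
proof
  fix X :: "nat \<Rightarrow> 'a \<rightarrow>\<^sub>C 'b"
  assume X: "Cauchy X"
  define R where "R f = Blinfun (cblinfun_apply f)" for f :: "'a \<rightarrow>\<^sub>C 'b"
  have R: "blinfun_apply (R f) = f" for f
    unfolding R_def by (simp add: Blinfun_inverse bounded_linear_cblinfun)
  show "convergent X"
  proof (rule convergent_if_closed_range[OF _ _ _ X, of R])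
    show "R (f - g) = R f - R g" for f g
      by (rule blinfun_eqI) (simp add: R blinfun.bilinear_simps)
    show "norm (R f) = norm f" for f
      by (simp add: norm_blinfun.rep_eq norm_cblinfun.rep_eq R)
    have "range R = {F. \<forall>c x. blinfun_apply F (c *\<^sub>C x) = c *\<^sub>C blinfun_apply F x}"
    proof (intro equalityI subsetI)
      fix F :: "'a \<Rightarrow>\<^sub>L 'b"
      assume "F \<in> {F. \<forall>c x. blinfun_apply F (c *\<^sub>C x) = c *\<^sub>C blinfun_apply F x}"
      then have "bounded_clinear (blinfun_apply F)"
        by (simp add: bounded_clinear_def blinfun.bounded_linear_right)
      then have "F = R (CBlinfun (blinfun_apply F))"
        by (intro blinfun_eqI) (simp add: R CBlinfun_apply)
      then show "F \<in> range R" by blast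
    qed (auto simp: R cblinfun_linear)
    also have "closed \<dots>"
      by (intro closed_Collect_all closed_Collect_eq
          bounded_linear.continuous_on[OF blinfun.bounded_linear_left]
          bounded_linear.continuous_on[OF bounded_linear_scaleC] continuous_on_id)
    finally show "closed (range R)" .
  qed
qed

type_synonym 'a dual = "'a \<rightarrow>\<^sub>C complex"

section \<open>The Hahn--Banach theorem\<close>

definition sublinear_on :: "'v::real_vector set \<Rightarrow> ('v \<Rightarrow> real) \<Rightarrow> bool"
  where "sublinear_on E q \<longleftrightarrow> (\<forall>x\<in>E. \<forall>y\<in>E. q (x + y) \<le> q x + q y) \<and>
    (\<forall>x\<in>E. \<forall>t\<ge>0. q (t *\<^sub>R x) = t * q x) \<and> (\<forall>x. x \<notin> E \<longrightarrow> q x = 0)"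

lemma sublinear_on_zero: "sublinear_on E q \<Longrightarrow> subspace E \<Longrightarrow> q 0 = 0"
  unfolding sublinear_on_def using subspace_0[of E]
  by (metis mult_zero_left order_refl scaleR_zero_left)

lemma sublinear_on_lower:
  assumes "sublinear_on E q" "subspace E" "x \<in> E"
  shows "- q (- x) \<le> q x"
proof -
  have "q (x + - x) \<le> q x + q (- x)"
    using assms unfolding sublinear_on_def by (meson subspace_neg)
  then show ?thesis using sublinear_on_zero[OF assms(1,2)] by simp
qed

lemma sublinear_on_envelope:
  assumes E: "subspace E" and K: "K \<noteq> {}"
    and bd: "\<And>x. x \<in> E \<Longrightarrow> bdd_below ((\<lambda>i. g i x) ` K)"
    and add: "\<And>x y i j. x \<in> E \<Longrightarrow> y \<in> E \<Longrightarrow> i \<in> K \<Longrightarrow> j \<in> K \<Longrightarrow>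
      \<exists>k\<in>K. g k (x + y) \<le> g i x + g j y"
    and scale: "\<And>x t i. x \<in> E \<Longrightarrow> t > 0 \<Longrightarrow> i \<in> K \<Longrightarrow> \<exists>k\<in>K. g k (t *\<^sub>R x) \<le> t * g i x"
    and zero: "\<And>i. i \<in> K \<Longrightarrow> g i 0 = (0::real)"
  shows "sublinear_on E (\<lambda>x. if x \<in> E then INF i\<in>K. g i x else 0)"
proof -
  define u where "u x = (INF i\<in>K. g i x)" for x
  have le: "u x \<le> g i x" if "x \<in> E" "i \<in> K" for x i
    unfolding u_def using bd that by (intro cINF_lower)
  have ge: "m \<le> u x" if "\<And>i. i \<in> K \<Longrightarrow> m \<le> g i x" for m x
    unfolding u_def using K that by (intro cINF_greatest)
  have 1: "u (x + y) \<le> u x + u y" if "x \<in> E" "y \<in> E" for x y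
  proof -
    have *: "u (x + y) \<le> g i x + g j y" if "i \<in> K" "j \<in> K" for i j
      using add[OF \<open>x \<in> E\<close> \<open>y \<in> E\<close> that] le[OF subspace_add[OF E \<open>x \<in> E\<close> \<open>y \<in> E\<close>]]
      by force
    have "u (x + y) - g i x \<le> u y" if "i \<in> K" for i
      using *[OF that] by (intro ge) (simp add: algebra_simps)
    then have "u (x + y) - u y \<le> u x"
      by (intro ge) (simp add: algebra_simps)
    then show ?thesis by simp
  qed
  have 2: "u (t *\<^sub>R x) \<le> t * u x" if "x \<in> E" "t > 0" for x t
  proof -
    have "u (t *\<^sub>R x) \<le> t * g i x" if "i \<in> K" for i
      using scale[OF \<open>x \<in> E\<close> \<open>t > 0\<close> that] le[OF subspace_scale[OF E \<open>x \<in> E\<close>], of _ t]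
        order_trans by blast
    then have "u (t *\<^sub>R x) / t \<le> u x"
      using \<open>t > 0\<close> by (intro ge) (simp add: field_simps)
    then show ?thesis using \<open>t > 0\<close> by (simp add: field_simps)
  qed
  have 3: "u (t *\<^sub>R x) = t * u x" if "x \<in> E" "t \<ge> 0" for x t
  proof (cases "t = 0")
    case True
    have "u 0 = 0" unfolding u_def using K zero by simp
    with True show ?thesis by simp
  next
    case False
    with that have "t > 0" by simp
    have "u (inverse t *\<^sub>R t *\<^sub>R x) \<le> inverse t * u (t *\<^sub>R x)"
      using that \<open>t > 0\<close> by (intro 2 subspace_scale[OF E]) auto
    then show ?thesis using 2[OF \<open>x \<in> E\<close> \<open>t > 0\<close>] \<open>t > 0\<close> by (simp add: field_simps)
  qed
  show ?thesis
    using 1 3 subspace_add[OF E] subspace_scale[OF E]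
    unfolding sublinear_on_def u_def[symmetric] by simp
qed

lemma sublinear_on_shift:
  assumes q: "sublinear_on E q" and E: "subspace E" and y: "y \<in> E"
  defines "q' \<equiv> \<lambda>x. if x \<in> E then INF t\<in>{0..}. q (x + t *\<^sub>R y) - t * q y else 0"
  shows "sublinear_on E q'" and "\<And>x. q' x \<le> q x"
    and "\<And>x. x \<in> E \<Longrightarrow> q' x \<le> q (x + y) - q y"
proof -
  have add: "q (x + z) \<le> q x + q z" if "x \<in> E" "z \<in> E" for x z
    using q that by (simp add: sublinear_on_def)
  have sc: "q (t *\<^sub>R x) = t * q x" if "x \<in> E" "t \<ge> 0" for x t
    using q that by (simp add: sublinear_on_def)
  have q0: "q 0 = 0" using q E by (rule sublinear_on_zero)
  have memE: "x + t *\<^sub>R y \<in> E" if "x \<in> E" for x t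
    using that y E by (intro subspace_add subspace_scale)
  have bd: "bdd_below ((\<lambda>t. q (x + t *\<^sub>R y) - t * q y) ` {0..})" if "x \<in> E" for x
  proof (rule bdd_belowI2)
    fix t :: real assume "t \<in> {0..}"
    then have "t * q y = q (t *\<^sub>R y)" using sc y by simp
    also have "\<dots> = q ((x + t *\<^sub>R y) + - x)" by simp
    also have "\<dots> \<le> q (x + t *\<^sub>R y) + q (- x)"
      using memE that E by (intro add) (auto simp: subspace_neg)
    finally show "- q (- x) \<le> q (x + t *\<^sub>R y) - t * q y" by simp
  qed
  show "sublinear_on E q'"
    unfolding q'_def
  proof (rule sublinear_on_envelope[OF E _ bd])
    fix x z and s t :: real assume *: "x \<in> E" "z \<in> E" "s \<in> {0..}" "t \<in> {0..}"
    have "q (x + z + (s + t) *\<^sub>R y) = q ((x + s *\<^sub>R y) + (z + t *\<^sub>R y))"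
      by (simp add: algebra_simps)
    also have "\<dots> \<le> q (x + s *\<^sub>R y) + q (z + t *\<^sub>R y)"
      using * by (intro add memE)
    finally show "\<exists>k\<in>{0..}. q (x + z + k *\<^sub>R y) - k * q y \<le>
        q (x + s *\<^sub>R y) - s * q y + (q (z + t *\<^sub>R y) - t * q y)"
      using * by (intro bexI[of _ "s + t"]) (auto simp: algebra_simps)
  next
    fix x and s t :: real assume *: "x \<in> E" "s > 0" "t \<in> {0..}"
    have "q (s *\<^sub>R x + (s * t) *\<^sub>R y) = q (s *\<^sub>R (x + t *\<^sub>R y))"
      by (simp add: algebra_simps)
    also have "\<dots> = s * q (x + t *\<^sub>R y)"
      using * by (intro sc memE) auto
    finally show "\<exists>k\<in>{0..}. q (s *\<^sub>R x + k *\<^sub>R y) - k * q y \<le> s * (q (x + t *\<^sub>R y) - t * q y)"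
      using * by (intro bexI[of _ "s * t"]) (auto simp: algebra_simps)
  qed (auto simp: sc y)
  have le: "q' x \<le> q (x + t *\<^sub>R y) - t * q y" if "x \<in> E" "t \<ge> 0" for x t
    using that cINF_lower[OF bd[OF \<open>x \<in> E\<close>], of t] by (simp add: q'_def)
  show "q' x \<le> q x" for x
  proof (cases "x \<in> E")
    case True then show ?thesis using le[of x 0] by simp
  next
    case False then show ?thesis using q by (simp add: q'_def sublinear_on_def)
  qed
  show "q' x \<le> q (x + y) - q y" if "x \<in> E" for x
    using le[OF that, of 1] by simp
qed

lemma minimal_sublinear_exists:
  assumes p: "sublinear_on E p" and E: "subspace E"
  obtains q where "sublinear_on E q" "\<And>x. q x \<le> p x"
    "\<And>q'. sublinear_on E q' \<Longrightarrow> (\<And>x. q' x \<le> q x) \<Longrightarrow> q' = q"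
proof -
  define A where "A = {q. sublinear_on E q \<and> q \<le> p}"
  define P where "P = (\<lambda>a b :: 'a \<Rightarrow> real. b \<le> a)"
  have "\<exists>m\<in>A. \<forall>a\<in>A. P m a \<longrightarrow> a = m"
  proof (rule predicate_Zorn)
    show "partial_order_on A (relation_of P A)"
      by (rule partial_order_on_relation_ofI) (auto simp: P_def)
  next
    fix C assume C: "C \<in> Chains (relation_of P A)"
    have CA: "C \<subseteq> A" and tot: "\<And>a b. a \<in> C \<Longrightarrow> b \<in> C \<Longrightarrow> a \<le> b \<or> b \<le> a"
      using C by (auto simp: Chains_def relation_of_def P_def)
    show "\<exists>u\<in>A. \<forall>a\<in>C. P a u"
    proof (cases "C = {}")
      case True
      then show ?thesis using p by (auto simp: A_def)
    next
      case False
      have sub: "sublinear_on E q" "q x \<le> p x" if "q \<in> C" for q x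
        using that CA by (auto simp: A_def le_fun_def)
      have bd: "bdd_below ((\<lambda>q. q x) ` C)" if "x \<in> E" for x
      proof (rule bdd_belowI2)
        fix q assume "q \<in> C"
        show "- p (- x) \<le> q x"
          using sublinear_on_lower[OF sub(1)[OF \<open>q \<in> C\<close>] E that] sub(2)[OF \<open>q \<in> C\<close>, of "- x"]
          by simp
      qed
      define u where "u x = (if x \<in> E then INF q\<in>C. q x else 0)" for x
      have "sublinear_on E u"
        unfolding u_def
      proof (rule sublinear_on_envelope[OF E False bd])
        fix x y q r assume *: "x \<in> E" "y \<in> E" "q \<in> C" "r \<in> C"
        consider "q \<le> r" | "r \<le> q" using tot * by blast
        then show "\<exists>k\<in>C. k (x + y) \<le> q x + r y"
        proof cases
          case 1
          have "q (x + y) \<le> q x + q y" using sub(1)[OF \<open>q \<in> C\<close>] * by (simp add: sublinear_on_def)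
          also have "q y \<le> r y" using 1 by (simp add: le_fun_def)
          finally show ?thesis using * by auto
        next
          case 2
          have "r (x + y) \<le> r x + r y" using sub(1)[OF \<open>r \<in> C\<close>] * by (simp add: sublinear_on_def)
          also have "r x \<le> q x" using 2 by (simp add: le_fun_def)
          finally show ?thesis using * by auto
        qed
      next
        fix x t q assume "x \<in> E" "t > (0::real)" "q \<in> C"
        then show "\<exists>k\<in>C. k (t *\<^sub>R x) \<le> t * q x"
          using sub(1)[OF \<open>q \<in> C\<close>] by (intro bexI[of _ q]) (auto simp: sublinear_on_def)
        next
        fix q assume "q \<in> C"
        then show "q 0 = 0" using sublinear_on_zero[OF sub(1) E] by simp
      qed
      moreover have uq: "u x \<le> q x" if "q \<in> C" for q x
        using sub(1)[OF that] cINF_lower[OF bd that] by (auto simp: u_def sublinear_on_def)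
      moreover have "u x \<le> p x" for x
      proof -
        obtain q where "q \<in> C" using False by blast
        then show ?thesis using uq[of q x] sub(2)[of q x] by simp
      qed
      ultimately show ?thesis
        by (intro bexI[of _ u]) (auto simp: A_def P_def le_fun_def)
    qed
  qed
  then obtain m where "m \<in> A" "\<And>a. a \<in> A \<Longrightarrow> a \<le> m \<Longrightarrow> a = m"
    by (auto simp: P_def)
  then have m: "sublinear_on E m" "\<And>x. m x \<le> p x"
    and min: "\<And>a. sublinear_on E a \<Longrightarrow> a \<le> p \<Longrightarrow> a \<le> m \<Longrightarrow> a = m"
    by (auto simp: A_def le_fun_def)
  show ?thesis
  proof (rule that[OF m])
    fix q' assume q': "sublinear_on E q'" "\<And>x. q' x \<le> m x"
    have "q' \<le> p" unfolding le_fun_def using q'(2) m(2) by (meson order_trans)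
    then show "q' = m" using q' by (intro min) (auto simp: le_fun_def)
  qed
qed

theorem hahn_banach_real:
  fixes p :: "'v::real_vector \<Rightarrow> real"
  assumes E: "subspace E"
    and p: "\<And>x y. x \<in> E \<Longrightarrow> y \<in> E \<Longrightarrow> p (x + y) \<le> p x + p y"
      "\<And>x t. x \<in> E \<Longrightarrow> t \<ge> 0 \<Longrightarrow> p (t *\<^sub>R x) = t * p x"
    and x0: "x0 \<in> E"
  obtains f where "\<And>x y. x \<in> E \<Longrightarrow> y \<in> E \<Longrightarrow> f (x + y) = f x + f y"
    "\<And>x t. x \<in> E \<Longrightarrow> f (t *\<^sub>R x) = t * f x"
    "\<And>x. x \<in> E \<Longrightarrow> f x \<le> p x" "f x0 = p x0"
proof -
  define p0 where "p0 x = (if x \<in> E then p x else 0)" for x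
  have p0: "sublinear_on E p0"
    using p subspace_add[OF E] subspace_scale[OF E] by (auto simp: p0_def sublinear_on_def)
  define p1 where "p1 x = (if x \<in> E then INF t\<in>{0..}. p0 (x + t *\<^sub>R x0) - t * p0 x0 else 0)" for x
  note shift = sublinear_on_shift[OF p0 E x0, folded p1_def]
  obtain q where q: "sublinear_on E q" and q_le: "\<And>x. q x \<le> p1 x"
    and q_min: "\<And>q'. sublinear_on E q' \<Longrightarrow> (\<And>x. q' x \<le> q x) \<Longrightarrow> q' = q"
  proof (rule minimal_sublinear_exists[OF shift(1) E])
    fix q assume 1: "sublinear_on E q" "\<And>x. q x \<le> p1 x"
      and 2: "\<And>q'. sublinear_on E q' \<Longrightarrow> (\<And>x. q' x \<le> q x) \<Longrightarrow> q' = q"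
    show thesis by (rule that[OF 1]) (rule 2)
  qed
  have q_p0: "q x \<le> p0 x" for x
    using q_le shift(2) by (rule order_trans)
  have q_x0: "q (- x0) \<le> - p0 x0"
    using order_trans[OF q_le shift(3), of "- x0"] x0 E sublinear_on_zero[OF p0 E]
    by (simp add: subspace_neg)
  have add: "q (x + y) = q x + q y" if "x \<in> E" "y \<in> E" for x y
  proof -
    define q' where "q' x = (if x \<in> E then INF t\<in>{0..}. q (x + t *\<^sub>R y) - t * q y else 0)" for x
    note s = sublinear_on_shift[OF q E \<open>y \<in> E\<close>, folded q'_def]
    have "q' = q" by (rule q_min[OF s(1,2)])
    then have "q x \<le> q (x + y) - q y" using s(3)[OF \<open>x \<in> E\<close>] by simp
    moreover have "q (x + y) \<le> q x + q y" using q that by (simp add: sublinear_on_def)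
    ultimately show ?thesis by simp
  qed
  have neg: "q (- x) = - q x" if "x \<in> E" for x
    using add[of x "- x"] that sublinear_on_zero[OF q E] by (simp add: E subspace_neg)
  show ?thesis
  proof (rule that[of q])
    show "q (t *\<^sub>R x) = t * q x" if "x \<in> E" for x t
    proof (cases "t \<ge> 0")
      case True then show ?thesis using q that by (simp add: sublinear_on_def)
    next
      case False
      then have "q ((- t) *\<^sub>R x) = - t * q x"
        using q that unfolding sublinear_on_def by (metis linear neg_0_le_iff_le)
      then show ?thesis using neg[OF subspace_scale[OF E that], of t] by simp
    qed
    show "q x \<le> p x" if "x \<in> E" for x using q_p0[of x] that by (simp add: p0_def)
    then have "q x0 \<le> p x0" using x0 .
    moreover have "p x0 \<le> q x0" using q_x0 neg[OF x0] x0 by (simp add: p0_def)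
    ultimately show "q x0 = p x0" by simp
  qed (fact add)
qed

theorem hahn_banach_complex:
  fixes p :: "'v::complex_normed_vector \<Rightarrow> real"
  assumes E0: "0 \<in> E" and Eadd: "\<And>x y. x \<in> E \<Longrightarrow> y \<in> E \<Longrightarrow> x + y \<in> E"
    and Esc: "\<And>c x. x \<in> E \<Longrightarrow> c *\<^sub>C x \<in> E"
    and p: "\<And>x y. x \<in> E \<Longrightarrow> y \<in> E \<Longrightarrow> p (x + y) \<le> p x + p y"
      "\<And>c x. x \<in> E \<Longrightarrow> p (c *\<^sub>C x) = cmod c * p x"
    and x0: "x0 \<in> E"
  obtains f where "\<And>x y. x \<in> E \<Longrightarrow> y \<in> E \<Longrightarrow> f (x + y) = f x + f y"
    "\<And>c x. x \<in> E \<Longrightarrow> f (c *\<^sub>C x) = c * f x"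
    "\<And>x. x \<in> E \<Longrightarrow> cmod (f x) \<le> p x" "f x0 = complex_of_real (p x0)"
proof -
  have E: "subspace E"
    by (auto simp: subspace_def E0 Eadd Esc scaleR_scaleC)
  obtain u where u: "\<And>x y. x \<in> E \<Longrightarrow> y \<in> E \<Longrightarrow> u (x + y) = u x + u y"
    "\<And>x t. x \<in> E \<Longrightarrow> u (t *\<^sub>R x) = t * u x"
    "\<And>x. x \<in> E \<Longrightarrow> u x \<le> p x" "u x0 = p x0"
    by (rule hahn_banach_real[OF E, of p x0]) (auto simp: p scaleR_scaleC x0)
  define f where "f x = Complex (u x) (- u (\<i> *\<^sub>C x))" for x
  have f_add: "f (x + y) = f x + f y" if "x \<in> E" "y \<in> E" for x y
    using that by (simp add: f_def complex_eq_iff scaleC_add_right u Esc)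
  have f_R: "f (complex_of_real t *\<^sub>C x) = complex_of_real t * f x" if "x \<in> E" for x t
  proof -
    have "\<i> *\<^sub>C complex_of_real t *\<^sub>C x = t *\<^sub>R (\<i> *\<^sub>C x)"
      by (simp add: scaleR_scaleC scaleC_scaleC mult.commute)
    then show ?thesis
      using that by (simp add: f_def complex_eq_iff scaleC_of_real u Esc)
  qed
  have f_i: "f (\<i> *\<^sub>C x) = \<i> * f x" if "x \<in> E" for x
  proof -
    have "u (- x) = - u x" using u(2)[OF that, of "-1"] by simp
    then show ?thesis
      by (simp add: f_def complex_eq_iff scaleC_scaleC scaleC_minus_left)
  qed
  have f_sc: "f (c *\<^sub>C x) = c * f x" if "x \<in> E" for c x
  proof -
    have "c *\<^sub>C x = complex_of_real (Re c) *\<^sub>C x + \<i> *\<^sub>C complex_of_real (Im c) *\<^sub>C x"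
      unfolding scaleC_scaleC scaleC_add_left[symmetric] by (simp add: complex_eq[symmetric])
    then have "f (c *\<^sub>C x) = complex_of_real (Re c) * f x + \<i> * (complex_of_real (Im c) * f x)"
      using that by (simp add: f_add f_R f_i Esc)
    also have "\<dots> = c * f x" by (subst (3) complex_eq) (simp add: algebra_simps)
    finally show ?thesis .
  qed
  have f_le: "cmod (f x) \<le> p x" if "x \<in> E" for x
  proof (cases "f x = 0")
    case True
    have "0 \<le> p x"
      using p(1)[OF that Esc[OF that, of "-1"]] p(2)[OF that, of "-1"] p(2)[OF that, of 0]
      by (simp add: scaleC_minus_left)
    with True show ?thesis by simp
  next
    case False
    define c where "c = cnj (f x) / cmod (f x)"
    have "cmod c = 1" using False by (simp add: c_def norm_divide)
    have "f x * cnj (f x) = complex_of_real (cmod (f x)) * complex_of_real (cmod (f x))"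
      using complex_norm_square[of "f x"] by (simp only: power2_eq_square of_real_mult)
    then have "c * f x = complex_of_real (cmod (f x))"
      using False by (simp add: c_def field_simps)
    then have "f (c *\<^sub>C x) = complex_of_real (cmod (f x))" using f_sc[OF that] by simp
    then have "cmod (f x) = u (c *\<^sub>C x)" by (simp add: f_def complex_eq_iff)
    also have "\<dots> \<le> p (c *\<^sub>C x)" using u(3) Esc that by simp
    also have "\<dots> = p x" using p(2)[OF that] \<open>cmod c = 1\<close> by simp
    finally show ?thesis .
  qed
  have "f x0 = complex_of_real (p x0)"
  proof -
    have "Re (f x0) = p x0" by (simp add: f_def u)
    moreover have "Im (f x0) = 0"
    proof -
      have "(cmod (f x0))\<^sup>2 \<le> (p x0)\<^sup>2"
        using f_le[OF x0] by (intro power_mono) auto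
      then show ?thesis using \<open>Re (f x0) = p x0\<close> by (simp add: cmod_power2)
    qed
    ultimately show ?thesis by (simp add: complex_eq_iff)
  qed
  with f_add f_sc f_le show ?thesis by (rule that)
qed

lemma norming_functional:
  fixes z :: "'z::complex_normed_vector"
  obtains h :: "'z dual" where "norm h \<le> 1" "h z = complex_of_real (norm z)"
proof -
  obtain f where f: "\<And>x y. f (x + y) = f x + f y" "\<And>c x. f (c *\<^sub>C x) = c * f x"
    "\<And>x. cmod (f x) \<le> norm x" "f z = complex_of_real (norm z)"
    by (rule hahn_banach_complex[of UNIV norm z]) (auto simp: norm_triangle_ineq norm_scaleC)
  have ap: "cblinfun_apply (CBlinfun f) = f"
    by (rule CBlinfun_apply'[where K=1]) (auto simp: f)
  have "norm (CBlinfun f) \<le> 1"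
    by (rule norm_CBlinfun) (auto simp: f)
  with f(4) ap show ?thesis by (intro that[of "CBlinfun f"]) simp_all
qed

section \<open>Bilinear maps, composition and the canonical embedding\<close>

definition cbilin ::
  "('a::complex_normed_vector \<Rightarrow> 'b::complex_normed_vector \<Rightarrow> 'c::complex_normed_vector) \<Rightarrow> 'a \<rightarrow>\<^sub>C 'b \<rightarrow>\<^sub>C 'c"
  where "cbilin f = CBlinfun (\<lambda>a. CBlinfun (\<lambda>b. f a b))"

definition bounded_cbilinear ::
  "('a::complex_normed_vector \<Rightarrow> 'b::complex_normed_vector \<Rightarrow> 'c::complex_normed_vector) \<Rightarrow> real \<Rightarrow> bool"
  where "bounded_cbilinear f K \<longleftrightarrow> 0 \<le> K \<and>
    (\<forall>a a' b. f (a + a') b = f a b + f a' b) \<and> (\<forall>a b b'. f a (b + b') = f a b + f a b') \<and>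
    (\<forall>c a b. f (c *\<^sub>C a) b = c *\<^sub>C f a b) \<and> (\<forall>c a b. f a (c *\<^sub>C b) = c *\<^sub>C f a b) \<and>
    (\<forall>a b. norm (f a b) \<le> K * norm a * norm b)"

lemma bounded_cbilinearI:
  assumes "\<And>a a' b. f (a + a') b = f a b + f a' b" "\<And>a b b'. f a (b + b') = f a b + f a b'"
    "\<And>c a b. f (c *\<^sub>C a) b = c *\<^sub>C f a b" "\<And>c a b. f a (c *\<^sub>C b) = c *\<^sub>C f a b"
    "\<And>a b. norm (f a b) \<le> K * norm a * norm b" "0 \<le> K"
  shows "bounded_cbilinear f K"
  using assms by (simp add: bounded_cbilinear_def)

lemma cbilin:
  assumes "bounded_cbilinear f K"
  shows cbilin_apply: "cbilin f a b = f a b" and norm_cbilin: "norm (cbilin f) \<le> K"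
proof -
  have f: "\<And>a a' b. f (a + a') b = f a b + f a' b" "\<And>a b b'. f a (b + b') = f a b + f a b'"
    "\<And>c a b. f (c *\<^sub>C a) b = c *\<^sub>C f a b" "\<And>c a b. f a (c *\<^sub>C b) = c *\<^sub>C f a b"
    "\<And>a b. norm (f a b) \<le> K * norm a * norm b" "0 \<le> K"
    using assms by (auto simp: bounded_cbilinear_def)
  have 1: "cblinfun_apply (CBlinfun (\<lambda>b. f a b)) = f a" for a
    by (rule CBlinfun_apply'[where K="K * norm a"]) (auto simp: f)
  have n: "norm (CBlinfun (\<lambda>b. f a b)) \<le> K * norm a" for a
    by (rule norm_CBlinfun) (auto simp: f)
  have add: "CBlinfun (\<lambda>b. f (a + a') b) = CBlinfun (\<lambda>b. f a b) + CBlinfun (\<lambda>b. f a' b)" for a a'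
    by (rule cblinfun_eqI) (unfold cblinfun_simps 1, rule f)
  have sc: "CBlinfun (\<lambda>b. f (c *\<^sub>C a) b) = c *\<^sub>C CBlinfun (\<lambda>b. f a b)" for a c
    by (rule cblinfun_eqI) (unfold cblinfun_simps 1, rule f)
  show "cbilin f a b = f a b"
    unfolding cbilin_def by (subst CBlinfun_apply'[OF add sc n]) (simp add: 1)
  show "norm (cbilin f) \<le> K"
    unfolding cbilin_def by (rule norm_CBlinfun[OF add sc n]) (rule f)
qed

definition cblinfun_compose ::
  "('b::complex_normed_vector \<rightarrow>\<^sub>C 'c::complex_normed_vector) \<Rightarrow> ('a::complex_normed_vector \<rightarrow>\<^sub>C 'b) \<Rightarrow> 'a \<rightarrow>\<^sub>C 'c"
  (infixl "o\<^sub>C" 55)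
  where "g o\<^sub>C f = CBlinfun (\<lambda>x. g (f x))"

lemma cblinfun_compose: "(g o\<^sub>C f) x = g (f x)" and norm_cblinfun_compose: "norm (g o\<^sub>C f) \<le> norm g * norm f"
proof -
  have 1: "norm (g (f x)) \<le> norm g * norm f * norm x" for x
  proof -
    have "norm (g (f x)) \<le> norm g * norm (f x)" by (rule norm_cblinfun)
    also have "\<dots> \<le> norm g * (norm f * norm x)" by (intro mult_left_mono norm_cblinfun) auto
    finally show ?thesis by (simp add: mult.assoc)
  qed
  show "(g o\<^sub>C f) x = g (f x)"
  proof -
    have "cblinfun_apply (CBlinfun (\<lambda>x. g (f x))) = (\<lambda>x. g (f x))"
      by (rule CBlinfun_apply'[where K="norm g * norm f"]) (simp_all add: cblinfun_linear 1)
    then show ?thesis by (simp add: cblinfun_compose_def)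
  qed
  show "norm (g o\<^sub>C f) \<le> norm g * norm f"
    unfolding cblinfun_compose_def by (rule norm_CBlinfun) (simp_all add: cblinfun_linear 1)
qed

definition eval_dual :: "'a::complex_normed_vector \<Rightarrow> 'a dual dual"
  where "eval_dual a = CBlinfun (\<lambda>f::'a dual. f a)"

lemma eval_dual: "eval_dual a f = f a" and norm_eval_dual_le: "norm (eval_dual a) \<le> norm a"
proof -
  have 1: "norm (f a) \<le> norm a * norm f" for f :: "'a dual"
    using norm_cblinfun[of f a] by (simp add: mult.commute)
  show "eval_dual a f = f a"
  proof -
    have "cblinfun_apply (CBlinfun (\<lambda>f::'a dual. f a)) = (\<lambda>f. f a)"
      by (rule CBlinfun_apply'[where K="norm a"]) (simp_all add: 1)
    then show ?thesis by (simp add: eval_dual_def)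
  qed
  show "norm (eval_dual a) \<le> norm a"
    unfolding eval_dual_def by (rule norm_CBlinfun) (simp_all add: 1)
qed

lemma norm_eval_dual: "norm (eval_dual a) = norm a"
proof (rule antisym[OF norm_eval_dual_le])
  obtain h :: "'a dual" where h: "norm h \<le> 1" "h a = complex_of_real (norm a)"
    by (rule norming_functional)
  have "norm a = cmod (eval_dual a h)" by (simp add: eval_dual h)
  also have "\<dots> \<le> norm (eval_dual a) * norm h" by (rule norm_cblinfun)
  also have "\<dots> \<le> norm (eval_dual a)" using h(1) by (simp add: mult_left_le)
  finally show "norm a \<le> norm (eval_dual a)" .
qed

lemma eval_dual_linear:
  "eval_dual (a + b) = eval_dual a + eval_dual b" "eval_dual (a - b) = eval_dual a - eval_dual b"
  "eval_dual (c *\<^sub>C a) = c *\<^sub>C eval_dual a"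
  by (auto intro!: cblinfun_eqI simp: eval_dual cblinfun_linear)

lemma bounded_clinear_eval_dual: "bounded_clinear eval_dual"
  by (rule bounded_clinearI[where K=1]) (simp_all add: eval_dual_linear norm_eval_dual)

lemma closed_range_eval_dual: "closed (range (eval_dual :: 'a::complex_banach \<Rightarrow> _))"
  by (intro complete_imp_closed complete_isometric_image[where e=1])
     (simp_all add: norm_eval_dual complete_UNIV bounded_clinearD[OF bounded_clinear_eval_dual])

section \<open>The projective tensor product\<close>

type_synonym ('a, 'b) bilin_form = "'a \<rightarrow>\<^sub>C 'b \<rightarrow>\<^sub>C complex"

definition elem_tensor ::
  "'a::complex_normed_vector \<Rightarrow> 'b::complex_normed_vector \<Rightarrow> ('a, 'b) bilin_form dual"
  where "elem_tensor a b = CBlinfun (\<lambda>B::('a, 'b) bilin_form. B a b)"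

lemma elem_tensor: "elem_tensor a b B = B a b"
  and norm_elem_tensor: "norm (elem_tensor a b) \<le> norm a * norm b"
proof -
  have 1: "norm (B a b) \<le> norm a * norm b * norm B" for B :: "('a, 'b) bilin_form"
  proof -
    have "norm (B a b) \<le> norm (B a) * norm b" by (rule norm_cblinfun)
    also have "\<dots> \<le> norm B * norm a * norm b" by (intro mult_right_mono norm_cblinfun) auto
    finally show ?thesis by (simp add: ac_simps)
  qed
  show "elem_tensor a b B = B a b"
  proof -
    have "cblinfun_apply (CBlinfun (\<lambda>B::('a, 'b) bilin_form. B a b)) = (\<lambda>B. B a b)"
      by (rule CBlinfun_apply'[where K="norm a * norm b"]) (simp_all add: 1)
    then show ?thesis by (simp add: elem_tensor_def)
  qed
  show "norm (elem_tensor a b) \<le> norm a * norm b"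
    unfolding elem_tensor_def by (rule norm_CBlinfun) (simp_all add: 1)
qed

definition elem_tensor_sum ::
  "('a::complex_normed_vector \<times> 'b::complex_normed_vector) list \<Rightarrow> ('a, 'b) bilin_form dual"
  where "elem_tensor_sum xs = (\<Sum>(a, b)\<leftarrow>xs. elem_tensor a b)"

lemma elem_tensor_sum_append: "elem_tensor_sum (xs @ ys) = elem_tensor_sum xs + elem_tensor_sum ys"
  by (simp add: elem_tensor_sum_def)

lemma elem_tensor_scaleC: "elem_tensor (c *\<^sub>C a) b = c *\<^sub>C elem_tensor a b"
  by (rule cblinfun_eqI) (simp add: elem_tensor cblinfun_linear)

lemma elem_tensor_sum_scale:
  "elem_tensor_sum (map (\<lambda>(a, b). (c *\<^sub>C a, b)) xs) = c *\<^sub>C elem_tensor_sum xs"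
  by (induction xs) (auto simp: elem_tensor_sum_def elem_tensor_scaleC scaleC_add_right)

lemma elem_tensor_sums_zero: "0 \<in> range elem_tensor_sum"
  by (rule image_eqI[of _ _ "[]"]) (simp_all add: elem_tensor_sum_def)

lemma elem_tensor_sums_add:
  assumes "x \<in> range elem_tensor_sum" "y \<in> range elem_tensor_sum"
  shows "x + y \<in> range elem_tensor_sum"
proof -
  obtain xs ys where "x = elem_tensor_sum xs" "y = elem_tensor_sum ys" using assms by blast
  then show ?thesis by (intro image_eqI[of _ _ "xs @ ys"]) (simp_all add: elem_tensor_sum_append)
qed

lemma elem_tensor_sums_scaleC:
  assumes "x \<in> range elem_tensor_sum"
  shows "c *\<^sub>C x \<in> range elem_tensor_sum"
proof -
  obtain xs where "x = elem_tensor_sum xs" using assms by blast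
  then show ?thesis
    by (intro image_eqI[of _ _ "map (\<lambda>(a, b). (c *\<^sub>C a, b)) xs"]) (simp_all add: elem_tensor_sum_scale)
qed

lemmas elem_tensor_sums_subspace = elem_tensor_sums_zero elem_tensor_sums_add elem_tensor_sums_scaleC

lemma closure_scaleC:
  fixes S :: "'v::complex_normed_vector set"
  assumes "\<And>x. x \<in> S \<Longrightarrow> c *\<^sub>C x \<in> S" and "x \<in> closure S"
  shows "c *\<^sub>C x \<in> closure S"
proof -
  have "(\<lambda>x. c *\<^sub>C x) ` closure S \<subseteq> closure S"
    by (rule image_closure_subset)
       (use assms(1) closure_subset in \<open>auto intro: bounded_linear.continuous_on[OF bounded_linear_scaleC]\<close>)
  with assms(2) show ?thesis by blast
qed

lemma closure_add:
  fixes S :: "'v::real_normed_vector set"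
  assumes "\<And>x y. x \<in> S \<Longrightarrow> y \<in> S \<Longrightarrow> x + y \<in> S" and "x \<in> closure S" "y \<in> closure S"
  shows "x + y \<in> closure S"
proof -
  obtain f g where "\<And>n. f n \<in> S" "f \<longlonglongrightarrow> x" "\<And>n. g n \<in> S" "g \<longlonglongrightarrow> y"
    using assms(2,3) by (auto simp: closure_sequential)
  then have "\<And>n. f n + g n \<in> S" "(\<lambda>n. f n + g n) \<longlonglongrightarrow> x + y"
    using assms(1) by (auto intro: tendsto_add)
  then show ?thesis unfolding closure_sequential by (intro exI[of _ "\<lambda>n. f n + g n"]) auto
qed

lemma closure_elem_tensor_sums:
  shows closure_elem_tensor_sums_zero: "0 \<in> closure (range elem_tensor_sum)"
    and closure_elem_tensor_sums_add: "x \<in> closure (range elem_tensor_sum) \<Longrightarrow>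
      y \<in> closure (range elem_tensor_sum) \<Longrightarrow> x + y \<in> closure (range elem_tensor_sum)"
    and closure_elem_tensor_sums_scaleC: "x \<in> closure (range elem_tensor_sum) \<Longrightarrow>
      c *\<^sub>C x \<in> closure (range elem_tensor_sum)"
  by (rule subsetD[OF closure_subset elem_tensor_sums_zero],
      rule closure_add, (rule elem_tensor_sums_add; assumption), assumption, assumption,
      rule closure_scaleC, (rule elem_tensor_sums_scaleC; assumption), assumption)

text \<open>
  An elementary tensor is represented by the functional \<open>B \<mapsto> B a b\<close> on the bounded bilinear
  forms, and the tensor product is the closure of the finite sums of these. On finite sums the
  dual norm is the projective norm \<open>inf (\<Sum> \<parallel>a\<parallel> \<parallel>b\<parallel>)\<close>, and so this is the completion of the
  algebraic tensor product in the projective norm (\<open>norm_tensor_sum\<close>, \<open>tensor_sums_dense\<close>, and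
  the universal property \<open>ptensor_universal\<close> with \<open>ptensor_eqI\<close>).
\<close>

typedef (overloaded) ('a, 'b) ptensor (infixr "\<otimes>\<^sub>p" 70) =
  "closure (range elem_tensor_sum) :: ('a::complex_normed_vector, 'b::complex_normed_vector) bilin_form dual set"
  by (rule exI) (rule closure_elem_tensor_sums_zero)

setup_lifting type_definition_ptensor

instantiation ptensor :: (complex_normed_vector, complex_normed_vector) complex_normed_vector
begin

lift_definition norm_ptensor :: "'a \<otimes>\<^sub>p 'b \<Rightarrow> real" is norm .

lift_definition zero_ptensor :: "'a \<otimes>\<^sub>p 'b" is 0
  by (rule closure_elem_tensor_sums_zero)

lift_definition plus_ptensor :: "'a \<otimes>\<^sub>p 'b \<Rightarrow> 'a \<otimes>\<^sub>p 'b \<Rightarrow> 'a \<otimes>\<^sub>p 'b" is "(+)"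
  by (rule closure_elem_tensor_sums_add)

lift_definition scaleC_ptensor :: "complex \<Rightarrow> 'a \<otimes>\<^sub>p 'b \<Rightarrow> 'a \<otimes>\<^sub>p 'b" is scaleC
  by (rule closure_elem_tensor_sums_scaleC)

lift_definition scaleR_ptensor :: "real \<Rightarrow> 'a \<otimes>\<^sub>p 'b \<Rightarrow> 'a \<otimes>\<^sub>p 'b" is scaleR
  unfolding scaleR_scaleC by (rule closure_elem_tensor_sums_scaleC)

lift_definition uminus_ptensor :: "'a \<otimes>\<^sub>p 'b \<Rightarrow> 'a \<otimes>\<^sub>p 'b" is uminus
  using closure_elem_tensor_sums_scaleC[where c="- 1"] by (simp add: scaleC_minus_left)

definition minus_ptensor :: "'a \<otimes>\<^sub>p 'b \<Rightarrow> 'a \<otimes>\<^sub>p 'b \<Rightarrow> 'a \<otimes>\<^sub>p 'b"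
  where "minus_ptensor u v = u + (- v)"
definition dist_ptensor :: "'a \<otimes>\<^sub>p 'b \<Rightarrow> 'a \<otimes>\<^sub>p 'b \<Rightarrow> real"
  where "dist_ptensor u v = norm (u - v)"
definition sgn_ptensor :: "'a \<otimes>\<^sub>p 'b \<Rightarrow> 'a \<otimes>\<^sub>p 'b"
  where "sgn_ptensor u = inverse (norm u) *\<^sub>R u"
definition uniformity_ptensor :: "(('a \<otimes>\<^sub>p 'b) \<times> ('a \<otimes>\<^sub>p 'b)) filter"
  where [code del]: "uniformity_ptensor = (INF e\<in>{0 <..}. principal {(x, y). dist x y < e})"
definition open_ptensor :: "('a \<otimes>\<^sub>p 'b) set \<Rightarrow> bool"
  where [code del]: "open_ptensor S = (\<forall>x\<in>S. \<forall>\<^sub>F (x', y) in uniformity. x' = x \<longrightarrow> y \<in> S)"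

instance
proof
  fix u v w :: "'a \<otimes>\<^sub>p 'b" and r s :: real and c d :: complex
  show "u + v + w = u + (v + w)" by transfer (simp add: add.assoc)
  show "u + v = v + u" by transfer (simp add: add.commute)
  show "0 + u = u" by transfer simp
  show "- u + u = 0" by transfer simp
  show "u - v = u + - v" by (simp add: minus_ptensor_def)
  show "r *\<^sub>R (u + v) = r *\<^sub>R u + r *\<^sub>R v" by transfer (simp add: algebra_simps)
  show "(r + s) *\<^sub>R u = r *\<^sub>R u + s *\<^sub>R u" by transfer (simp add: algebra_simps)
  show "r *\<^sub>R s *\<^sub>R u = (r * s) *\<^sub>R u" by transfer simp
  show "1 *\<^sub>R u = u" by transfer simp
  show "dist u v = norm (u - v)" by (simp add: dist_ptensor_def)
  show "sgn u = inverse (norm u) *\<^sub>R u" by (simp add: sgn_ptensor_def)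
  show "uniformity = (INF e\<in>{0<..}. principal {(x::'a \<otimes>\<^sub>p 'b, y). dist x y < e})"
    by (simp add: uniformity_ptensor_def)
  show "open S = (\<forall>x\<in>S. \<forall>\<^sub>F (x', y) in uniformity. x' = x \<longrightarrow> y \<in> S)" for S :: "('a \<otimes>\<^sub>p 'b) set"
    by (simp add: open_ptensor_def)
  show "(norm u = 0) = (u = 0)" by transfer simp
  show "norm (u + v) \<le> norm u + norm v" by transfer (rule norm_triangle_ineq)
  show "norm (r *\<^sub>R u) = \<bar>r\<bar> * norm u" by transfer simp
  show "c *\<^sub>C (u + v) = c *\<^sub>C u + c *\<^sub>C v" by transfer (rule scaleC_add_right)
  show "(c + d) *\<^sub>C u = c *\<^sub>C u + d *\<^sub>C u" by transfer (rule scaleC_add_left)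
  show "c *\<^sub>C d *\<^sub>C u = (c * d) *\<^sub>C u" by transfer (rule scaleC_scaleC)
  show "complex_of_real r *\<^sub>C u = r *\<^sub>R u" by transfer (rule scaleC_of_real)
  show "norm (c *\<^sub>C u) = cmod c * norm u" by transfer (rule norm_scaleC)
qed

end

lemma Rep_ptensor_diff: "Rep_ptensor (u - v) = Rep_ptensor u - Rep_ptensor v"
  unfolding minus_ptensor_def plus_ptensor.rep_eq uminus_ptensor.rep_eq by simp

instance ptensor :: (complex_normed_vector, complex_normed_vector) complex_banach
proof
  fix X :: "nat \<Rightarrow> 'a \<otimes>\<^sub>p 'b"
  assume X: "Cauchy X"
  show "convergent X"
  proof (rule convergent_if_closed_range[of Rep_ptensor, OF _ _ _ X])
    show "closed (range (Rep_ptensor :: 'a \<otimes>\<^sub>p 'b \<Rightarrow> _))"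
      unfolding type_definition.Rep_range[OF type_definition_ptensor] by (rule closed_closure)
  qed (simp_all only: Rep_ptensor_diff norm_ptensor.rep_eq)
qed

lift_definition tensor :: "'a::complex_normed_vector \<Rightarrow> 'b::complex_normed_vector \<Rightarrow> 'a \<otimes>\<^sub>p 'b"
  (infixr "\<otimes>" 70) is elem_tensor
proof -
  fix a :: 'a and b :: 'b
  have "elem_tensor a b = elem_tensor_sum [(a, b)]" by (simp add: elem_tensor_sum_def)
  then show "elem_tensor a b \<in> closure (range elem_tensor_sum)"
    by (simp only: subsetD[OF closure_subset rangeI])
qed

lemma tensor_add_left: "(a + a') \<otimes> b = a \<otimes> b + a' \<otimes> b"
  by transfer (auto intro!: cblinfun_eqI simp: elem_tensor cblinfun_linear)

lemma tensor_add_right: "a \<otimes> (b + b') = a \<otimes> b + a \<otimes> b'"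
  by transfer (auto intro!: cblinfun_eqI simp: elem_tensor cblinfun_linear)

lemma tensor_scaleC_left: "(c *\<^sub>C a) \<otimes> b = c *\<^sub>C (a \<otimes> b)"
  by transfer (auto intro!: cblinfun_eqI simp: elem_tensor cblinfun_linear)

lemma tensor_scaleC_right: "a \<otimes> (c *\<^sub>C b) = c *\<^sub>C (a \<otimes> b)"
  by transfer (auto intro!: cblinfun_eqI simp: elem_tensor cblinfun_linear)

lemma norm_tensor_le: "norm (a \<otimes> b) \<le> norm a * norm b"
  by transfer (rule norm_elem_tensor)

lemma Rep_tensor_sum: "Rep_ptensor (\<Sum>(a, b)\<leftarrow>xs. a \<otimes> b) = elem_tensor_sum xs"
  by (induction xs)
     (auto simp: elem_tensor_sum_def zero_ptensor.rep_eq plus_ptensor.rep_eq tensor.rep_eq)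

theorem norm_tensor_sum:
  fixes xs :: "('a::complex_normed_vector \<times> 'b::complex_normed_vector) list"
  shows "norm (\<Sum>(a, b)\<leftarrow>xs. a \<otimes> b) =
    Inf {(\<Sum>(a, b)\<leftarrow>ys. norm a * norm b) |ys. (\<Sum>(a, b)\<leftarrow>ys. a \<otimes> b) = (\<Sum>(a, b)\<leftarrow>xs. a \<otimes> b)}"
proof -
  define w :: "('a \<times> 'b) list \<Rightarrow> real" where "w ys = (\<Sum>(a, b)\<leftarrow>ys. norm a * norm b)" for ys
  define p where "p u = Inf {w ys |ys. elem_tensor_sum ys = u}" for u
  have w_nonneg: "0 \<le> w ys" for ys by (auto simp: w_def intro!: sum_list_nonneg)
  have bdd: "bdd_below {w ys |ys. elem_tensor_sum ys = u}" for u
    by (rule bdd_belowI[of _ 0]) (auto simp: w_nonneg)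
  have p_le: "p (elem_tensor_sum ys) \<le> w ys" for ys
    unfolding p_def by (rule cInf_lower) (auto simp: bdd)
  have p_ge: "m \<le> p u" if "u \<in> range elem_tensor_sum" "\<And>ys. elem_tensor_sum ys = u \<Longrightarrow> m \<le> w ys" for m u
    unfolding p_def using that by (intro cInf_greatest) auto
  have p_add: "p (u + v) \<le> p u + p v"
    if "u \<in> range elem_tensor_sum" "v \<in> range elem_tensor_sum" for u v
  proof -
    have *: "p (u + v) \<le> w ys + w zs" if "elem_tensor_sum ys = u" "elem_tensor_sum zs = v" for ys zs
      using p_le[of "ys @ zs"] that by (simp add: elem_tensor_sum_append) (simp add: w_def)
    have "p (u + v) - w ys \<le> p v" if "elem_tensor_sum ys = u" for ys
      using *[OF that] by (intro p_ge \<open>v \<in> _\<close>) (simp add: algebra_simps)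
    then have "p (u + v) - p v \<le> p u"
      by (intro p_ge \<open>u \<in> _\<close>) (simp add: algebra_simps)
    then show ?thesis by simp
  qed
  have w_scale: "w (map (\<lambda>(a, b). (c *\<^sub>C a, b)) ys) = cmod c * w ys" for c ys
    by (induction ys) (auto simp: w_def norm_scaleC algebra_simps)
  have p_scale_le: "p (c *\<^sub>C u) \<le> cmod c * p u" if u: "u \<in> range elem_tensor_sum" for c u
  proof (cases "c = 0")
    case True
    have "p 0 \<le> 0" using p_le[of "[]"] by (simp add: elem_tensor_sum_def w_def)
    with True show ?thesis by simp
  next
    case False
    have "p (c *\<^sub>C u) \<le> cmod c * w ys" if "elem_tensor_sum ys = u" for ys
      using p_le[of "map (\<lambda>(a, b). (c *\<^sub>C a, b)) ys"] that
      by (simp add: elem_tensor_sum_scale w_scale)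
    then have "p (c *\<^sub>C u) / cmod c \<le> p u"
      using False by (intro p_ge u) (simp add: field_simps)
    then show ?thesis using False by (simp add: field_simps)
  qed
  have p_scale: "p (c *\<^sub>C u) = cmod c * p u" if u: "u \<in> range elem_tensor_sum" for c u
  proof (cases "c = 0")
    case True
    have "p 0 = 0"
      using p_le[of "[]"] p_ge[OF elem_tensor_sums_subspace(1), of 0]
      by (intro antisym) (auto simp: elem_tensor_sum_def w_def intro!: w_nonneg[unfolded w_def])
    with True show ?thesis by simp
  next
    case False
    have "p (inverse c *\<^sub>C c *\<^sub>C u) \<le> cmod (inverse c) * p (c *\<^sub>C u)"
      by (rule p_scale_le) (rule elem_tensor_sums_subspace(3)[OF u])
    then have "cmod c * p u \<le> p (c *\<^sub>C u)"
      using False by (simp add: scaleC_scaleC norm_divide field_simps)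
    with p_scale_le[OF u] show ?thesis by (intro antisym)
  qed
  define u where "u = elem_tensor_sum xs"
  have u_range: "u \<in> range elem_tensor_sum" by (simp add: u_def)
  obtain f where f:
    "\<And>x y. x \<in> range elem_tensor_sum \<Longrightarrow> y \<in> range elem_tensor_sum \<Longrightarrow> f (x + y) = f x + f y"
    "\<And>c x. x \<in> range elem_tensor_sum \<Longrightarrow> f (c *\<^sub>C x) = c * f x"
    "\<And>x. x \<in> range elem_tensor_sum \<Longrightarrow> cmod (f x) \<le> p x" "f u = complex_of_real (p u)"
  proof (rule hahn_banach_complex[OF elem_tensor_sums_subspace p_add p_scale u_range])
    fix f
    assume *: "\<And>x y. x \<in> range elem_tensor_sum \<Longrightarrow> y \<in> range elem_tensor_sum \<Longrightarrow> f (x + y) = f x + f y"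
      "\<And>c x. x \<in> range elem_tensor_sum \<Longrightarrow> f (c *\<^sub>C x) = c * f x"
      "\<And>x. x \<in> range elem_tensor_sum \<Longrightarrow> cmod (f x) \<le> p x" "f u = complex_of_real (p u)"
    show thesis by (rule that[of f]) (fact *)+
  qed
  have e: "elem_tensor a b \<in> range elem_tensor_sum" for a :: 'a and b :: 'b
    by (rule image_eqI[of _ _ "[(a, b)]"]) (simp_all add: elem_tensor_sum_def)
  have e_lin: "elem_tensor (a + a') b = elem_tensor a b + elem_tensor a' b"
    "elem_tensor a (b + b') = elem_tensor a b + elem_tensor a b'"
    "elem_tensor a (c *\<^sub>C b) = c *\<^sub>C elem_tensor a b" for a a' :: 'a and b b' :: 'b and c
    by (auto intro!: cblinfun_eqI simp: elem_tensor cblinfun_linear)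
  have bb: "bounded_cbilinear (\<lambda>a b. f (elem_tensor a b)) 1"
  proof (rule bounded_cbilinearI)
    fix a :: 'a and b :: 'b
    have "cmod (f (elem_tensor a b)) \<le> p (elem_tensor a b)" by (rule f(3)[OF e])
    also have "\<dots> \<le> norm a * norm b"
      using p_le[of "[(a, b)]"] by (simp add: elem_tensor_sum_def w_def)
    finally show "norm (f (elem_tensor a b)) \<le> 1 * norm a * norm b" by simp
  qed (auto simp: e_lin elem_tensor_scaleC f e)
  define B where "B = cbilin (\<lambda>a b. f (elem_tensor a b))"
  have "elem_tensor_sum ys B = f (elem_tensor_sum ys)" for ys
  proof (induction ys)
    case Nil
    have "f 0 = 0" using f(2)[OF elem_tensor_sums_subspace(1), of 0] by simp
    then show ?case by (simp add: elem_tensor_sum_def)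
  next
    case (Cons y ys)
    obtain a b where y: "y = (a, b)" by (cases y)
    have "elem_tensor_sum (y # ys) = elem_tensor a b + elem_tensor_sum ys"
      by (simp add: elem_tensor_sum_def y)
    with Cons show ?case
      by (simp add: f(1)[OF e] elem_tensor B_def cbilin_apply[OF bb])
  qed
  then have "p u = cmod (u B)"
    using f(4) p_ge[of u 0] w_nonneg by (simp add: u_def)
  also have "\<dots> \<le> norm u * norm B" by (rule norm_cblinfun)
  also have "\<dots> \<le> norm u" using norm_cbilin[OF bb] by (simp add: B_def mult_left_le)
  finally have "p u \<le> norm u" .
  moreover have "norm u \<le> p u"
  proof (rule p_ge)
    fix ys :: "('a \<times> 'b) list" assume "elem_tensor_sum ys = u"
    moreover have "norm (elem_tensor_sum ys) \<le> w ys"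
    proof (induction ys)
      case (Cons y ys)
      obtain a b where y: "y = (a, b)" by (cases y)
      have "norm (elem_tensor_sum (y # ys)) \<le> norm (elem_tensor a b) + norm (elem_tensor_sum ys)"
        by (simp add: elem_tensor_sum_def y norm_triangle_ineq)
      also have "\<dots> \<le> norm a * norm b + w ys" using norm_elem_tensor Cons by (rule add_mono)
      finally show ?case by (simp add: w_def y)
    qed (simp add: elem_tensor_sum_def w_def)
    ultimately show "norm u \<le> w ys" by simp
  qed (simp add: u_def)
  ultimately have "norm u = p u" by simp
  then show ?thesis
    by (simp add: norm_ptensor.rep_eq Rep_tensor_sum u_def p_def w_def flip: Rep_ptensor_inject)
qed

lemma tensor_sums_dense: "closure (range (\<lambda>xs. \<Sum>(a, b)\<leftarrow>xs. a \<otimes> b)) = UNIV"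
proof -
  have "u \<in> closure (range (\<lambda>xs. \<Sum>(a, b)\<leftarrow>xs. a \<otimes> b))" for u :: "'a \<otimes>\<^sub>p 'b"
    unfolding closure_approachable
  proof (intro allI impI)
    fix e :: real assume "e > 0"
    have "Rep_ptensor u \<in> closure (range elem_tensor_sum)" by (rule Rep_ptensor)
    with \<open>e > 0\<close> obtain xs where "dist (elem_tensor_sum xs) (Rep_ptensor u) < e"
      by (auto simp: closure_approachable)
    then have "dist (\<Sum>(a, b)\<leftarrow>xs. a \<otimes> b) u < e"
      by (simp add: dist_norm norm_ptensor.rep_eq Rep_ptensor_diff Rep_tensor_sum)
    then show "\<exists>y\<in>range (\<lambda>xs. \<Sum>(a, b)\<leftarrow>xs. a \<otimes> b). dist y u < e" by blast
  qed
  then show ?thesis by blast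
qed

lemma ptensor_eqI:
  fixes L M :: "'a::complex_normed_vector \<otimes>\<^sub>p 'b::complex_normed_vector \<rightarrow>\<^sub>C 'c::complex_normed_vector"
  assumes "\<And>a b. L (a \<otimes> b) = M (a \<otimes> b)"
  shows "L = M"
proof -
  have 1: "L (\<Sum>(a, b)\<leftarrow>xs. a \<otimes> b) = M (\<Sum>(a, b)\<leftarrow>xs. a \<otimes> b)" for xs
    by (induction xs) (auto simp: cblinfun_linear assms)
  have "closed {u. L u = M u}"
    by (intro closed_Collect_eq bounded_linear.continuous_on[OF bounded_linear_cblinfun] continuous_on_id)
  then have "closure (range (\<lambda>xs. \<Sum>(a, b)\<leftarrow>xs. a \<otimes> b)) \<subseteq> {u. L u = M u}"
    by (intro closure_minimal) (auto simp: 1)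
  then show ?thesis
    by (intro cblinfun_eqI) (auto simp: tensor_sums_dense)
qed

theorem ptensor_universal:
  fixes f :: "'a::complex_normed_vector \<rightarrow>\<^sub>C 'b::complex_normed_vector \<rightarrow>\<^sub>C 'z::complex_banach"
  shows "\<exists>L :: 'a \<otimes>\<^sub>p 'b \<rightarrow>\<^sub>C 'z. (\<forall>a b. cblinfun_apply L (a \<otimes> b) = f a b) \<and> norm L = norm f"
proof -
  define F :: "'z dual \<Rightarrow> ('a, 'b) bilin_form" where "F h = cbilin (\<lambda>a b. h (f a b))" for h
  have bbF: "bounded_cbilinear (\<lambda>a b. h (f a b)) (norm f * norm h)" for h :: "'z dual"
  proof (rule bounded_cbilinearI)
    fix a b
    have "norm (h (f a b)) \<le> norm h * norm (f a b)" by (rule norm_cblinfun)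
    also have "\<dots> \<le> norm h * (norm (f a) * norm b)" by (intro mult_left_mono norm_cblinfun) auto
    also have "\<dots> \<le> norm h * (norm f * norm a * norm b)"
      by (intro mult_left_mono mult_right_mono norm_cblinfun) auto
    finally show "norm (h (f a b)) \<le> norm f * norm h * norm a * norm b" by (simp add: ac_simps)
  qed (auto simp: cblinfun_linear)
  have F: "F h a b = h (f a b)" and nF: "norm (F h) \<le> norm f * norm h" for h a b
    unfolding F_def using cbilin[OF bbF] by auto
  have F_lin: "F (h + k) = F h + F k" "F (c *\<^sub>C h) = c *\<^sub>C F h" for h k c
    by (auto intro!: cblinfun_eqI simp: F)
  define S where "S v = v o\<^sub>C CBlinfun F" for v :: "('a, 'b) bilin_form dual"
  have S: "S v h = v (F h)" for v h
  proof -
    have "cblinfun_apply (CBlinfun F) = F" by (rule CBlinfun_apply'[where K="norm f"]) (fact F_lin nF)+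
    then show ?thesis by (simp add: S_def cblinfun_compose)
  qed
  have "norm (CBlinfun F) \<le> norm f" by (rule norm_CBlinfun) (fact F_lin nF norm_ge_zero)+
  then have nS: "norm (S v) \<le> norm f * norm v" for v
    unfolding S_def using norm_cblinfun_compose[of v "CBlinfun F"]
    by (smt (verit) mult.commute mult_left_mono norm_ge_zero)
  have S_lin: "S (v + w) = S v + S w" "S (c *\<^sub>C v) = c *\<^sub>C S v" for v w c
    by (auto intro!: cblinfun_eqI simp: S)
  have S_e: "S (elem_tensor a b) = eval_dual (f a b)" for a b
    by (rule cblinfun_eqI) (simp add: S elem_tensor F eval_dual)
  have S_0: "S 0 = eval_dual 0" by (rule cblinfun_eqI) (simp add: S eval_dual cblinfun_linear)
  have "S (elem_tensor_sum xs) \<in> range eval_dual" for xs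
  proof (induction xs)
    case Nil show ?case by (simp add: elem_tensor_sum_def S_0)
  next
    case (Cons x xs)
    then obtain z where "S (elem_tensor_sum xs) = eval_dual z" by auto
    then have "S (elem_tensor_sum (x # xs)) = eval_dual (f (fst x) (snd x) + z)"
      by (simp add: elem_tensor_sum_def case_prod_beta S_lin S_e eval_dual_linear)
    then show ?case by blast
  qed
  moreover have "continuous_on A S" for A
    by (rule bounded_linear.continuous_on[OF bounded_clinearD[OF bounded_clinearI[OF S_lin nS]] continuous_on_id])
  ultimately have "S ` closure (range elem_tensor_sum) \<subseteq> range eval_dual"
    by (intro image_closure_subset closed_range_eval_dual) auto
  then have "\<exists>z. S (Rep_ptensor u) = eval_dual z" for u
    using Rep_ptensor by blast
  then obtain L0 where L0: "S (Rep_ptensor u) = eval_dual (L0 u)" for u by metis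
  have inj: "x = y" if "eval_dual x = eval_dual y" for x y :: 'z
    using that norm_eval_dual[of "x - y"] by (simp add: eval_dual_linear)
  have L0_add: "L0 (u + v) = L0 u + L0 v" for u v
    by (rule inj) (simp add: eval_dual_linear plus_ptensor.rep_eq S_lin flip: L0)
  have L0_sc: "L0 (c *\<^sub>C u) = c *\<^sub>C L0 u" for u c
    by (rule inj) (simp add: eval_dual_linear scaleC_ptensor.rep_eq S_lin flip: L0)
  have nL0: "norm (L0 u) \<le> norm f * norm u" for u
    using nS[of "Rep_ptensor u"] by (simp add: L0 norm_eval_dual norm_ptensor.rep_eq)
  define L where "L = CBlinfun L0"
  have L: "cblinfun_apply L = L0" unfolding L_def by (rule CBlinfun_apply'[OF L0_add L0_sc nL0])
  have Lt: "L (a \<otimes> b) = f a b" for a b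
    by (rule inj) (simp add: L tensor.rep_eq S_e flip: L0)
  have "norm L \<le> norm f" unfolding L_def by (rule norm_CBlinfun[OF L0_add L0_sc nL0]) simp
  moreover have "norm f \<le> norm L"
  proof (rule norm_cblinfun_bound)
    fix a
    show "norm (f a) \<le> norm L * norm a"
    proof (rule norm_cblinfun_bound)
      fix b
      have "norm (f a b) \<le> norm L * norm (a \<otimes> b)"
        unfolding Lt[symmetric] by (rule norm_cblinfun)
      also have "\<dots> \<le> norm L * (norm a * norm b)" by (intro mult_left_mono norm_tensor_le) auto
      finally show "norm (f a b) \<le> norm L * norm a * norm b" by (simp add: mult.assoc)
    qed simp
  qed simp
  ultimately show ?thesis using Lt by (intro exI[of _ L]) auto
qed

definition ptensor_lift ::
  "('a::complex_normed_vector \<rightarrow>\<^sub>C 'b::complex_normed_vector \<rightarrow>\<^sub>C 'z::complex_banach) \<Rightarrow> 'a \<otimes>\<^sub>p 'b \<rightarrow>\<^sub>C 'z"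
  where "ptensor_lift f = (THE L. \<forall>a b. cblinfun_apply L (a \<otimes> b) = f a b)"

lemma ptensor_lift_tensor: "ptensor_lift f (a \<otimes> b) = f a b"
  and norm_ptensor_lift: "norm (ptensor_lift f) = norm f"
proof -
  obtain L where L: "\<forall>a b. cblinfun_apply L (a \<otimes> b) = f a b" "norm L = norm f"
    using ptensor_universal by blast
  have "ptensor_lift f = L"
    unfolding ptensor_lift_def
    by (rule the_equality) (use L in \<open>auto intro: ptensor_eqI\<close>)
  with L show "ptensor_lift f (a \<otimes> b) = f a b" "norm (ptensor_lift f) = norm f" by auto
qed

section \<open>Adjoints and module actions\<close>

definition adjoint ::
  "('a::complex_normed_vector \<rightarrow>\<^sub>C 'b::complex_normed_vector) \<Rightarrow> 'b dual \<rightarrow>\<^sub>C 'a dual"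
  where "adjoint T = CBlinfun (\<lambda>f. f o\<^sub>C T)"

lemma adjoint_compose: "adjoint T f = f o\<^sub>C T"
  and adjoint_apply: "adjoint T f x = f (T x)"
  and norm_adjoint: "norm (adjoint T) \<le> norm T"
proof -
  have 1: "norm (f o\<^sub>C T) \<le> norm T * norm f" for f :: "'b dual"
    using norm_cblinfun_compose[of f T] by (simp add: mult.commute)
  have add: "(f + g) o\<^sub>C T = (f o\<^sub>C T) + (g o\<^sub>C T)" for f g :: "'b dual"
    by (rule cblinfun_eqI) (simp add: cblinfun_compose)
  have sc: "(c *\<^sub>C f) o\<^sub>C T = c *\<^sub>C (f o\<^sub>C T)" for f :: "'b dual" and c
    by (rule cblinfun_eqI) (simp add: cblinfun_compose)
  have *: "cblinfun_apply (CBlinfun (\<lambda>f::'b dual. f o\<^sub>C T)) = (\<lambda>f. f o\<^sub>C T)"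
    by (rule CBlinfun_apply'[where K="norm T"]) (fact add sc 1)+
  show "adjoint T f = f o\<^sub>C T" by (simp add: adjoint_def *)
  show "adjoint T f x = f (T x)" by (simp add: adjoint_def * cblinfun_compose)
  show "norm (adjoint T) \<le> norm T"
    unfolding adjoint_def by (rule norm_CBlinfun) (fact add sc 1 norm_ge_zero)+
qed

definition lmult :: "'a::complex_banach_algebra \<Rightarrow> 'a \<rightarrow>\<^sub>C 'a"
  where "lmult = cblinfun_apply (cbilin (*))"

lemma bounded_cbilinear_mult: "bounded_cbilinear ((*) :: 'a::complex_banach_algebra \<Rightarrow> _) 1"
  by (rule bounded_cbilinearI)
     (simp_all add: algebra_simps mult_scaleC_left mult_scaleC_right norm_mult_ineq)

lemma lmult_apply: "lmult a b = a * b"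
  unfolding lmult_def by (rule cbilin_apply[OF bounded_cbilinear_mult])

lemma lmult_linear: "lmult (a + b) = lmult a + lmult b" "lmult (c *\<^sub>C a) = c *\<^sub>C lmult a"
  unfolding lmult_def by (simp_all add: cblinfun_linear)

lemma norm_lmult: "norm (lmult a) \<le> norm a"
  by (rule norm_cblinfun_bound) (simp_all add: lmult_apply norm_mult_ineq)

section \<open>The bidual with the first Arens product\<close>

typedef (overloaded) 'a bidual = "UNIV :: 'a::complex_banach_algebra dual dual set" ..

setup_lifting type_definition_bidual

text \<open>
  For \<open>G\<close> in the bidual, \<open>f\<close> in the dual and \<open>a\<close> in the algebra: \<open>(f \<cdot> a)(b) = f (a b)\<close> is
  \<open>adjoint (lmult a) f\<close>, and \<open>(G \<cdot> f)(a) = G (f \<cdot> a)\<close> is \<open>arens_action G f\<close>.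
  The first Arens product is \<open>(F G)(f) = F (G \<cdot> f)\<close>.
\<close>

definition arens_action :: "'a::complex_banach_algebra dual dual \<Rightarrow> 'a dual \<rightarrow>\<^sub>C 'a dual"
  where "arens_action G = cbilin (\<lambda>f a. G (adjoint (lmult a) f))"

lemma bounded_cbilinear_arens_action:
  fixes G :: "'a::complex_banach_algebra dual dual"
  shows "bounded_cbilinear (\<lambda>f a. G (adjoint (lmult a) f)) (norm G)"
proof (rule bounded_cbilinearI)
  fix f g :: "'a dual" and a b :: 'a and c :: complex
  show "G (adjoint (lmult a) (f + g)) = G (adjoint (lmult a) f) + G (adjoint (lmult a) g)"
    "G (adjoint (lmult a) (c *\<^sub>C f)) = c *\<^sub>C G (adjoint (lmult a) f)"
    by (simp_all only: cblinfun_linear)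
  have "adjoint (lmult (a + b)) f = adjoint (lmult a) f + adjoint (lmult b) f"
    by (rule cblinfun_eqI) (simp add: adjoint_apply lmult_linear cblinfun_linear)
  then show "G (adjoint (lmult (a + b)) f) = G (adjoint (lmult a) f) + G (adjoint (lmult b) f)"
    by (simp add: cblinfun_linear)
  have "adjoint (lmult (c *\<^sub>C a)) f = c *\<^sub>C adjoint (lmult a) f"
    by (rule cblinfun_eqI) (simp add: adjoint_apply lmult_linear cblinfun_linear)
  then show "G (adjoint (lmult (c *\<^sub>C a)) f) = c *\<^sub>C G (adjoint (lmult a) f)"
    by (simp add: cblinfun_linear)
  have "norm (G (adjoint (lmult a) f)) \<le> norm G * norm (adjoint (lmult a) f)"
    by (rule norm_cblinfun)
  also have "norm (adjoint (lmult a) f) \<le> norm (adjoint (lmult a)) * norm f"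
    by (rule norm_cblinfun)
  also have "norm (adjoint (lmult a)) \<le> norm a"
    by (rule order_trans[OF norm_adjoint norm_lmult])
  finally show "norm (G (adjoint (lmult a) f)) \<le> norm G * norm f * norm a"
    by (simp add: mult_left_mono mult_right_mono mult.assoc) (simp add: mult.commute)
qed simp

lemma arens_action_apply: "arens_action G f a = G (adjoint (lmult a) f)"
  and norm_arens_action: "norm (arens_action G) \<le> norm G"
  unfolding arens_action_def using cbilin[OF bounded_cbilinear_arens_action] by auto

instantiation bidual :: (complex_banach_algebra) complex_normed_vector
begin

lift_definition norm_bidual :: "'a bidual \<Rightarrow> real" is norm .
lift_definition zero_bidual :: "'a bidual" is 0 .
lift_definition plus_bidual :: "'a bidual \<Rightarrow> 'a bidual \<Rightarrow> 'a bidual" is "(+)" .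
lift_definition minus_bidual :: "'a bidual \<Rightarrow> 'a bidual \<Rightarrow> 'a bidual" is "(-)" .
lift_definition uminus_bidual :: "'a bidual \<Rightarrow> 'a bidual" is uminus .
lift_definition scaleC_bidual :: "complex \<Rightarrow> 'a bidual \<Rightarrow> 'a bidual" is scaleC .
lift_definition scaleR_bidual :: "real \<Rightarrow> 'a bidual \<Rightarrow> 'a bidual" is scaleR .

definition dist_bidual :: "'a bidual \<Rightarrow> 'a bidual \<Rightarrow> real"
  where "dist_bidual F G = norm (F - G)"
definition sgn_bidual :: "'a bidual \<Rightarrow> 'a bidual"
  where "sgn_bidual F = inverse (norm F) *\<^sub>R F"
definition uniformity_bidual :: "('a bidual \<times> 'a bidual) filter"
  where [code del]: "uniformity_bidual = (INF e\<in>{0 <..}. principal {(x, y). dist x y < e})"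
definition open_bidual :: "'a bidual set \<Rightarrow> bool"
  where [code del]: "open_bidual S = (\<forall>x\<in>S. \<forall>\<^sub>F (x', y) in uniformity. x' = x \<longrightarrow> y \<in> S)"

instance
proof
  fix F G H :: "'a bidual" and r s :: real and c d :: complex
  show "F + G + H = F + (G + H)" by transfer (rule add.assoc)
  show "F + G = G + F" by transfer (rule add.commute)
  show "0 + F = F" by transfer (rule add_0_left)
  show "- F + F = 0" by transfer (rule left_minus)
  show "F - G = F + - G" by transfer (rule diff_conv_add_uminus)
  show "r *\<^sub>R (F + G) = r *\<^sub>R F + r *\<^sub>R G" by transfer (rule scaleR_add_right)
  show "(r + s) *\<^sub>R F = r *\<^sub>R F + s *\<^sub>R F" by transfer (rule scaleR_add_left)
  show "r *\<^sub>R s *\<^sub>R F = (r * s) *\<^sub>R F" by transfer (rule scaleR_scaleR)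
  show "1 *\<^sub>R F = F" by transfer (rule scaleR_one)
  show "dist F G = norm (F - G)" by (simp only: dist_bidual_def)
  show "sgn F = inverse (norm F) *\<^sub>R F" by (simp only: sgn_bidual_def)
  show "uniformity = (INF e\<in>{0<..}. principal {(x::'a bidual, y). dist x y < e})"
    by (simp only: uniformity_bidual_def)
  show "open S = (\<forall>x\<in>S. \<forall>\<^sub>F (x', y) in uniformity. x' = x \<longrightarrow> y \<in> S)" for S :: "'a bidual set"
    by (simp only: open_bidual_def)
  show "(norm F = 0) = (F = 0)" by transfer (rule norm_eq_zero)
  show "norm (F + G) \<le> norm F + norm G" by transfer (rule norm_triangle_ineq)
  show "norm (r *\<^sub>R F) = \<bar>r\<bar> * norm F" by transfer (rule norm_scaleR)
  show "c *\<^sub>C (F + G) = c *\<^sub>C F + c *\<^sub>C G" by transfer (rule scaleC_add_right)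
  show "(c + d) *\<^sub>C F = c *\<^sub>C F + d *\<^sub>C F" by transfer (rule scaleC_add_left)
  show "c *\<^sub>C d *\<^sub>C F = (c * d) *\<^sub>C F" by transfer (rule scaleC_scaleC)
  show "complex_of_real r *\<^sub>C F = r *\<^sub>R F" by transfer (rule scaleC_of_real)
  show "norm (c *\<^sub>C F) = cmod c * norm F" by transfer (rule norm_scaleC)
qed

end

instance bidual :: (complex_banach_algebra) complex_banach
proof
  fix X :: "nat \<Rightarrow> 'a bidual"
  assume X: "Cauchy X"
  show "convergent X"
  proof (rule convergent_if_closed_range[of Rep_bidual, OF _ _ _ X])
    show "closed (range (Rep_bidual :: 'a bidual \<Rightarrow> _))"
      unfolding type_definition.Rep_range[OF type_definition_bidual] by (rule closed_UNIV)
  qed (simp_all only: minus_bidual.rep_eq norm_bidual.rep_eq)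
qed

instantiation bidual :: (complex_banach_algebra) complex_banach_algebra
begin

lift_definition times_bidual :: "'a bidual \<Rightarrow> 'a bidual \<Rightarrow> 'a bidual"
  is "\<lambda>F G. F o\<^sub>C arens_action G" .

instance
proof
  fix F G H :: "'a bidual" and r s :: real and c d :: complex
  show "F * G * H = F * (G * H)"
  proof transfer
    fix F G H :: "'a dual dual"
    have "arens_action H (adjoint (lmult a) f) = adjoint (lmult a) (arens_action H f)" for a f
    proof (rule cblinfun_eqI)
      fix b
      have "adjoint (lmult b) (adjoint (lmult a) f) = adjoint (lmult (a * b)) f"
        by (rule cblinfun_eqI) (simp add: adjoint_apply lmult_apply mult.assoc)
      then show "arens_action H (adjoint (lmult a) f) b = adjoint (lmult a) (arens_action H f) b"
        by (simp add: arens_action_apply adjoint_apply lmult_apply)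
    qed
    then have "arens_action G (arens_action H f) = arens_action (G o\<^sub>C arens_action H) f" for f
      by (intro cblinfun_eqI) (simp add: arens_action_apply cblinfun_compose)
    then show "F o\<^sub>C arens_action G o\<^sub>C arens_action H = F o\<^sub>C arens_action (G o\<^sub>C arens_action H)"
      by (intro cblinfun_eqI) (simp add: cblinfun_compose)
  qed
  have lin: "arens_action (G + H) f = arens_action G f + arens_action H f"
    "arens_action (c *\<^sub>C G) f = c *\<^sub>C arens_action G f"
    for G H :: "'a dual dual" and f c
    by (rule cblinfun_eqI, simp add: arens_action_apply)+
  show "(F + G) * H = F * H + G * H"
    by transfer (auto intro!: cblinfun_eqI simp: cblinfun_compose)
  show "F * (G + H) = F * G + F * H"
    by transfer (auto intro!: cblinfun_eqI simp: cblinfun_compose lin cblinfun_linear)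
  show C1: "(c *\<^sub>C F) * G = c *\<^sub>C (F * G)" for c
    by transfer (auto intro!: cblinfun_eqI simp: cblinfun_compose)
  show C2: "F * (c *\<^sub>C G) = c *\<^sub>C (F * G)" for c
    by transfer (auto intro!: cblinfun_eqI simp: cblinfun_compose lin cblinfun_linear)
  have R: "r *\<^sub>R F = complex_of_real r *\<^sub>C F" for r and F :: "'a bidual"
    by transfer (rule scaleR_scaleC)
  show "(r *\<^sub>R F) * G = r *\<^sub>R (F * G)" "F * (r *\<^sub>R G) = r *\<^sub>R (F * G)"
    by (simp_all only: R C1 C2)
  show "norm (F * G) \<le> norm F * norm G"
  proof transfer
    fix F G :: "'a dual dual"
    have "norm (F o\<^sub>C arens_action G) \<le> norm F * norm (arens_action G)"
      by (rule norm_cblinfun_compose)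
    also have "\<dots> \<le> norm F * norm G" by (intro mult_left_mono norm_arens_action norm_ge_zero)
    finally show "norm (F o\<^sub>C arens_action G) \<le> norm F * norm G" .
  qed
qed

end

section \<open>Upper triangular matrices\<close>

lemma summable_if_sums_bounded:
  fixes f :: "'k \<Rightarrow> real"
  assumes "\<And>x. 0 \<le> f x" and "\<And>F. finite F \<Longrightarrow> sum f F \<le> B"
  shows "f summable_on UNIV" and "infsum f UNIV \<le> B"
proof -
  show "f summable_on UNIV"
    by (rule nonneg_bdd_above_summable_on) (auto intro!: bdd_aboveI2[where M=B] assms)
  then show "infsum f UNIV \<le> B" by (rule infsum_le_finite_sums) (rule assms(2))
qed

lemma infsum_of_bounded_linear:
  "bounded_linear h \<Longrightarrow> f summable_on A \<Longrightarrow> infsum (\<lambda>x. h (f x)) A = h (infsum f A)"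
  by (rule infsumI) (rule has_sum_bounded_linear[OF _ has_sum_infsum])

text \<open>
  The totally ordered index set is the type \<open>'i\<close>. The condition that the sum of the norms of
  all entries is finite is unconditional summability over all pairs of indices.
\<close>

typedef (overloaded) ('i, 'a) up_matrix =
  "{m :: 'i::linorder \<Rightarrow> 'i \<Rightarrow> 'a::complex_banach_algebra.
      (\<forall>i j. \<not> i \<le> j \<longrightarrow> m i j = 0) \<and> (\<lambda>(i, j). norm (m i j)) summable_on UNIV}"
  morphisms up_entry Abs_up_matrix
  by (rule exI[of _ "\<lambda>_ _. 0"]) (simp add: case_prod_unfold)

setup_lifting type_definition_up_matrix

lemma up_entry_lower: "\<not> i \<le> j \<Longrightarrow> up_entry m i j = 0"
  using up_entry[of m] by blast

lemma up_entry_summable: "(\<lambda>x. norm (up_entry m (fst x) (snd x))) summable_on UNIV"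
  using up_entry[of m] by (simp add: case_prod_unfold)

lemma up_matrix_eqI: "(\<And>i j. up_entry m i j = up_entry n i j) \<Longrightarrow> m = n"
  by (simp add: up_entry_inject[symmetric] fun_eq_iff)

definition up_sum_norm :: "('i \<Rightarrow> 'i \<Rightarrow> 'a::real_normed_vector) \<Rightarrow> real"
  where "up_sum_norm m = (\<Sum>\<^sub>\<infinity>(i, j)\<in>UNIV. norm (m i j))"

lemma finite_sum_le_up_sum_norm:
  assumes "finite F"
  shows "(\<Sum>x\<in>F. norm (up_entry m (fst x) (snd x))) \<le> up_sum_norm (up_entry m)"
  unfolding up_sum_norm_def case_prod_unfold
  by (rule finite_sum_le_infsum[OF up_entry_summable assms]) simp_all

lemma up_sum_norm_nonneg: "0 \<le> up_sum_norm m"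
  unfolding up_sum_norm_def by (rule infsum_nonneg) (simp add: case_prod_unfold)

lemma norm_entry_le_up_sum_norm: "norm (up_entry m i j) \<le> up_sum_norm (up_entry m)"
  using finite_sum_le_up_sum_norm[of "{(i, j)}" m] by simp

lemma up_sum_norm_triangle:
  shows "(\<lambda>x. norm (up_entry m (fst x) (snd x) + up_entry n (fst x) (snd x))) summable_on UNIV"
    and "up_sum_norm (\<lambda>i j. up_entry m i j + up_entry n i j) \<le>
      up_sum_norm (up_entry m) + up_sum_norm (up_entry n)"
proof -
  let ?f = "\<lambda>x. norm (up_entry m (fst x) (snd x) + up_entry n (fst x) (snd x))"
  have "sum ?f F \<le> up_sum_norm (up_entry m) + up_sum_norm (up_entry n)" if "finite F" for F
  proof -
    have "sum ?f F \<le> (\<Sum>x\<in>F. norm (up_entry m (fst x) (snd x)) + norm (up_entry n (fst x) (snd x)))"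
      by (intro sum_mono norm_triangle_ineq)
    also have "\<dots> \<le> up_sum_norm (up_entry m) + up_sum_norm (up_entry n)"
      unfolding sum.distrib using that by (intro add_mono finite_sum_le_up_sum_norm)
    finally show ?thesis .
  qed
  from summable_if_sums_bounded[OF norm_ge_zero this]
  show "?f summable_on UNIV"
    and "up_sum_norm (\<lambda>i j. up_entry m i j + up_entry n i j) \<le>
      up_sum_norm (up_entry m) + up_sum_norm (up_entry n)"
    by (simp_all add: up_sum_norm_def case_prod_unfold)
qed

lemma up_sum_norm_scale:
  "(\<lambda>x. norm (c *\<^sub>C up_entry m (fst x) (snd x))) summable_on UNIV"
  "up_sum_norm (\<lambda>i j. c *\<^sub>C up_entry m i j) = cmod c * up_sum_norm (up_entry m)"
  unfolding up_sum_norm_def norm_scaleC case_prod_unfold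
  by (rule summable_on_cmult_right[OF up_entry_summable])
     (rule infsum_cmult_right[OF up_entry_summable])

instantiation up_matrix :: (linorder, complex_banach_algebra) complex_normed_vector
begin

lift_definition norm_up_matrix :: "('a, 'b) up_matrix \<Rightarrow> real"
  is "\<lambda>m. \<Sum>\<^sub>\<infinity>(i, j)\<in>UNIV. norm (m i j)" .

lift_definition zero_up_matrix :: "('a, 'b) up_matrix" is "\<lambda>_ _. 0"
  by (simp add: case_prod_unfold)

lift_definition plus_up_matrix :: "('a, 'b) up_matrix \<Rightarrow> ('a, 'b) up_matrix \<Rightarrow> ('a, 'b) up_matrix"
  is "\<lambda>m n i j. m i j + n i j"
proof (intro conjI allI impI; (elim conjE)?)
  fix m n :: "'a \<Rightarrow> 'a \<Rightarrow> 'b"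
  assume m: "\<forall>i j. \<not> i \<le> j \<longrightarrow> m i j = 0" "(\<lambda>(i, j). norm (m i j)) summable_on UNIV"
    and n: "\<forall>i j. \<not> i \<le> j \<longrightarrow> n i j = 0" "(\<lambda>(i, j). norm (n i j)) summable_on UNIV"
  show "m i j + n i j = 0" if "\<not> i \<le> j" for i j
    using m(1) n(1) that by simp
  show "(\<lambda>(i, j). norm (m i j + n i j)) summable_on UNIV"
    using up_sum_norm_triangle(1)[of "Abs_up_matrix m" "Abs_up_matrix n"] m n
    by (simp add: Abs_up_matrix_inverse case_prod_unfold)
qed

lift_definition scaleC_up_matrix :: "complex \<Rightarrow> ('a, 'b) up_matrix \<Rightarrow> ('a, 'b) up_matrix"
  is "\<lambda>c m i j. c *\<^sub>C m i j"
  by (simp add: norm_scaleC case_prod_unfold summable_on_cmult_right)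

lift_definition scaleR_up_matrix :: "real \<Rightarrow> ('a, 'b) up_matrix \<Rightarrow> ('a, 'b) up_matrix"
  is "\<lambda>r m i j. r *\<^sub>R m i j"
  by (simp add: case_prod_unfold summable_on_cmult_right)

lift_definition uminus_up_matrix :: "('a, 'b) up_matrix \<Rightarrow> ('a, 'b) up_matrix"
  is "\<lambda>m i j. - m i j"
  by simp

definition minus_up_matrix :: "('a, 'b) up_matrix \<Rightarrow> ('a, 'b) up_matrix \<Rightarrow> ('a, 'b) up_matrix"
  where "minus_up_matrix m n = m + (- n)"
definition dist_up_matrix :: "('a, 'b) up_matrix \<Rightarrow> ('a, 'b) up_matrix \<Rightarrow> real"
  where "dist_up_matrix m n = norm (m - n)"
definition sgn_up_matrix :: "('a, 'b) up_matrix \<Rightarrow> ('a, 'b) up_matrix"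
  where "sgn_up_matrix m = inverse (norm m) *\<^sub>R m"
definition uniformity_up_matrix :: "(('a, 'b) up_matrix \<times> ('a, 'b) up_matrix) filter"
  where [code del]: "uniformity_up_matrix = (INF e\<in>{0 <..}. principal {(x, y). dist x y < e})"
definition open_up_matrix :: "('a, 'b) up_matrix set \<Rightarrow> bool"
  where [code del]: "open_up_matrix S = (\<forall>x\<in>S. \<forall>\<^sub>F (x', y) in uniformity. x' = x \<longrightarrow> y \<in> S)"

lemma norm_up_matrix: "norm m = up_sum_norm (up_entry m)"
  by (simp add: norm_up_matrix.rep_eq up_sum_norm_def)

instance
proof
  fix m n k :: "('a, 'b) up_matrix" and r s :: real and c d :: complex
  show "m + n + k = m + (n + k)" by transfer (simp add: add.assoc)
  show "m + n = n + m" by transfer (simp add: add.commute)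
  show "0 + m = m" by transfer simp
  show "- m + m = 0" by transfer simp
  show "m - n = m + - n" by (simp only: minus_up_matrix_def)
  show "r *\<^sub>R (m + n) = r *\<^sub>R m + r *\<^sub>R n" by transfer (simp add: scaleR_add_right)
  show "(r + s) *\<^sub>R m = r *\<^sub>R m + s *\<^sub>R m" by transfer (simp add: scaleR_add_left)
  show "r *\<^sub>R s *\<^sub>R m = (r * s) *\<^sub>R m" by transfer simp
  show "1 *\<^sub>R m = m" by transfer simp
  show "dist m n = norm (m - n)" by (simp only: dist_up_matrix_def)
  show "sgn m = inverse (norm m) *\<^sub>R m" by (simp only: sgn_up_matrix_def)
  show "uniformity = (INF e\<in>{0<..}. principal {(x::('a, 'b) up_matrix, y). dist x y < e})"
    by (simp only: uniformity_up_matrix_def)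
  show "open S = (\<forall>x\<in>S. \<forall>\<^sub>F (x', y) in uniformity. x' = x \<longrightarrow> y \<in> S)"
    for S :: "('a, 'b) up_matrix set"
    by (simp only: open_up_matrix_def)
  show "(norm m = 0) = (m = 0)"
  proof
    assume "norm m = 0"
    then have "up_entry m i j = 0" for i j
      using norm_entry_le_up_sum_norm[of m i j] by (simp add: norm_up_matrix)
    then show "m = 0" by (intro up_matrix_eqI) (simp add: zero_up_matrix.rep_eq)
  next
    assume "m = 0"
    then show "norm m = 0"
      by (simp add: norm_up_matrix up_sum_norm_def zero_up_matrix.rep_eq case_prod_unfold)
  qed
  show "norm (m + n) \<le> norm m + norm n"
    unfolding norm_up_matrix plus_up_matrix.rep_eq by (rule up_sum_norm_triangle)
  have R: "r *\<^sub>R m = complex_of_real r *\<^sub>C m" by transfer (simp add: scaleR_scaleC)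
  then show "complex_of_real r *\<^sub>C m = r *\<^sub>R m" by (rule sym)
  show C: "norm (c *\<^sub>C m) = cmod c * norm m" for c
    unfolding norm_up_matrix scaleC_up_matrix.rep_eq by (rule up_sum_norm_scale)
  show "norm (r *\<^sub>R m) = \<bar>r\<bar> * norm m" unfolding R C by simp
  show "c *\<^sub>C (m + n) = c *\<^sub>C m + c *\<^sub>C n" by transfer (simp add: scaleC_add_right)
  show "(c + d) *\<^sub>C m = c *\<^sub>C m + d *\<^sub>C m" by transfer (simp add: scaleC_add_left)
  show "c *\<^sub>C d *\<^sub>C m = (c * d) *\<^sub>C m" by transfer (simp add: scaleC_scaleC)
qed

end

lemma up_entry_simps [simp]:
  "up_entry (m + n) i j = up_entry m i j + up_entry n i j"
  "up_entry (- m) i j = - up_entry m i j"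
  "up_entry (m - n) i j = up_entry m i j - up_entry n i j"
  "up_entry (c *\<^sub>C m) i j = c *\<^sub>C up_entry m i j"
  "up_entry (r *\<^sub>R m) i j = r *\<^sub>R up_entry m i j"
  "up_entry 0 i j = 0"
  unfolding minus_up_matrix_def
  by (simp_all only: plus_up_matrix.rep_eq uminus_up_matrix.rep_eq scaleC_up_matrix.rep_eq
      scaleR_up_matrix.rep_eq zero_up_matrix.rep_eq diff_conv_add_uminus)

lemma norm_up_entry: "norm (up_entry m i j) \<le> norm m"
  unfolding norm_up_matrix by (rule norm_entry_le_up_sum_norm)

lemma finite_sum_le_norm_up:
  "finite F \<Longrightarrow> (\<Sum>x\<in>F. norm (up_entry m (fst x) (snd x))) \<le> norm m"
  unfolding norm_up_matrix by (rule finite_sum_le_up_sum_norm)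

lemma up_entry_Abs:
  assumes "\<And>i j. \<not> i \<le> j \<Longrightarrow> m i j = 0" "(\<lambda>x. norm (m (fst x) (snd x))) summable_on UNIV"
  shows "up_entry (Abs_up_matrix m) = m"
  by (rule Abs_up_matrix_inverse) (use assms in \<open>simp add: case_prod_unfold\<close>)

instance up_matrix :: (linorder, complex_banach_algebra) complex_banach
proof
  fix X :: "nat \<Rightarrow> ('a, 'b) up_matrix"
  assume X: "Cauchy X"
  have "Cauchy (\<lambda>n. up_entry (X n) i j)" for i j
  proof (rule CauchyI)
    fix e :: real assume "0 < e"
    with X obtain M where "\<forall>m\<ge>M. \<forall>n\<ge>M. norm (X m - X n) < e" by (meson CauchyD)
    then show "\<exists>M. \<forall>m\<ge>M. \<forall>n\<ge>M. norm (up_entry (X m) i j - up_entry (X n) i j) < e"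
      using norm_up_entry[of "X _ - X _" i j] by (metis up_entry_simps(3) le_less_trans)
  qed
  then have "\<exists>l. (\<lambda>n. up_entry (X n) i j) \<longlonglongrightarrow> l" for i j
    by (simp add: Cauchy_convergent_iff convergent_def)
  then obtain L where L: "\<And>i j. (\<lambda>n. up_entry (X n) i j) \<longlonglongrightarrow> L i j" by metis
  have lower: "L i j = 0" if "\<not> i \<le> j" for i j
    using L[of i j] by (simp add: up_entry_lower[OF that] LIMSEQ_const_iff)
  have bound: "(\<Sum>x\<in>F. norm (L (fst x) (snd x) - up_entry (X m) (fst x) (snd x))) \<le> e"
    if "finite F" "\<forall>n\<ge>M. \<forall>m\<ge>M. norm (X n - X m) < e" "m \<ge> M" for F e m M
  proof (rule LIMSEQ_le_const2)
    show "(\<lambda>n. \<Sum>x\<in>F. norm (up_entry (X n) (fst x) (snd x) - up_entry (X m) (fst x) (snd x)))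
      \<longlonglongrightarrow> (\<Sum>x\<in>F. norm (L (fst x) (snd x) - up_entry (X m) (fst x) (snd x)))"
      by (intro tendsto_intros L)
    have "(\<Sum>x\<in>F. norm (up_entry (X n) (fst x) (snd x) - up_entry (X m) (fst x) (snd x))) \<le> e"
      if "n \<ge> M" for n
      using finite_sum_le_norm_up[OF \<open>finite F\<close>, of "X n - X m"] that
        \<open>\<forall>n\<ge>M. \<forall>m\<ge>M. norm (X n - X m) < e\<close> \<open>m \<ge> M\<close> by force
    then show "\<exists>N. \<forall>n\<ge>N.
      (\<Sum>x\<in>F. norm (up_entry (X n) (fst x) (snd x) - up_entry (X m) (fst x) (snd x))) \<le> e"
      by blast
  qed
  have diff: "\<exists>D. (\<forall>i j. up_entry D i j = L i j - up_entry (X m) i j) \<and> norm D \<le> e"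
    if "\<forall>n\<ge>M. \<forall>m\<ge>M. norm (X n - X m) < e" "m \<ge> M" for e m M
  proof -
    let ?D = "\<lambda>i j. L i j - up_entry (X m) i j"
    note s = summable_if_sums_bounded[OF norm_ge_zero bound[OF _ that]]
    have D: "up_entry (Abs_up_matrix ?D) = ?D"
      by (rule up_entry_Abs) (simp_all add: lower up_entry_lower s(1))
    have "norm (Abs_up_matrix ?D) \<le> e"
      unfolding norm_up_matrix D up_sum_norm_def case_prod_unfold by (rule s(2))
    with D show ?thesis by (intro exI[of _ "Abs_up_matrix ?D"]) simp
  qed
  obtain M1 where "\<forall>n\<ge>M1. \<forall>m\<ge>M1. norm (X n - X m) < 1"
    using CauchyD[OF X, of 1] by auto
  from diff[OF this order_refl] obtain D1 where D1: "\<And>i j. up_entry D1 i j = L i j - up_entry (X M1) i j"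
    by blast
  define Y where "Y = D1 + X M1"
  have Y: "up_entry Y i j = L i j" for i j by (simp add: Y_def D1)
  have "X \<longlonglongrightarrow> Y"
  proof (rule LIMSEQ_I)
    fix e :: real assume "0 < e"
    then obtain M where M: "\<forall>n\<ge>M. \<forall>m\<ge>M. norm (X n - X m) < e / 2"
      using CauchyD[OF X, of "e / 2"] by auto
    have "norm (X m - Y) < e" if m: "m \<ge> M" for m
    proof -
      obtain D where D: "\<And>i j. up_entry D i j = L i j - up_entry (X m) i j" "norm D \<le> e / 2"
        using diff[OF M m] by blast
      have "X m - Y = - D" by (rule up_matrix_eqI) (simp add: Y D)
      with D(2) \<open>0 < e\<close> show ?thesis by simp
    qed
    then show "\<exists>M. \<forall>m\<ge>M. norm (X m - Y) < e" by blast
  qed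
  then show "convergent X" by (auto simp: convergent_def)
qed

lemma up_product_summable:
  fixes m n :: "('i::linorder, 'a::complex_banach_algebra) up_matrix"
  defines "T \<equiv> \<lambda>x. norm (up_entry m (fst (fst x)) (snd x)) * norm (up_entry n (snd x) (snd (fst x)))"
  shows "T summable_on UNIV" and "infsum T UNIV \<le> norm m * norm n"
proof -
  have "sum T F \<le> norm m * norm n" if F: "finite F" for F
  proof -
    define h :: "('i \<times> 'i) \<times> 'i \<Rightarrow> ('i \<times> 'i) \<times> ('i \<times> 'i)"
      where "h x = ((fst (fst x), snd x), (snd x, snd (fst x)))" for x
    define g where "g y = norm (up_entry m (fst (fst y)) (snd (fst y))) *
      norm (up_entry n (fst (snd y)) (snd (snd y)))" for y
    have inj: "inj_on h F" by (auto simp: inj_on_def h_def prod_eq_iff)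
    have "sum T F = sum g (h ` F)"
      unfolding sum.reindex[OF inj] by (simp add: T_def g_def h_def)
    also have "\<dots> \<le> sum g (fst ` h ` F \<times> snd ` h ` F)"
      using F by (intro sum_mono2 subset_fst_snd) (simp_all add: g_def)
    also have "\<dots> = (\<Sum>y\<in>fst ` h ` F. norm (up_entry m (fst y) (snd y))) *
        (\<Sum>z\<in>snd ` h ` F. norm (up_entry n (fst z) (snd z)))"
      by (simp add: g_def sum_product sum.cartesian_product case_prod_unfold)
    also have "\<dots> \<le> norm m * norm n"
      using F by (intro mult_mono finite_sum_le_norm_up) (auto intro!: sum_nonneg)
    finally show ?thesis .
  qed
  then show "T summable_on UNIV" and "infsum T UNIV \<le> norm m * norm n"
    by (rule summable_if_sums_bounded[rotated]; simp add: T_def)+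
qed

lemma up_product_row_abs_summable:
  fixes m n :: "('i::linorder, 'a::complex_banach_algebra) up_matrix"
  shows "(\<lambda>k. norm (up_entry m i k) * norm (up_entry n k j)) summable_on UNIV"
proof -
  have "(\<lambda>(x, k). norm (up_entry m (fst x) k) * norm (up_entry n k (snd x))) summable_on UNIV \<times> UNIV"
    using up_product_summable(1)[of m n] by (simp add: case_prod_unfold)
  from summable_on_SigmaD1[OF this, of "(i, j)"] show ?thesis by simp
qed

lemma up_product_row_summable:
  fixes m n :: "('i::linorder, 'a::complex_banach_algebra) up_matrix"
  shows "(\<lambda>k. norm (up_entry m i k * up_entry n k j)) summable_on UNIV"
    and "(\<lambda>k. up_entry m i k * up_entry n k j) summable_on UNIV"
proof -
  show "(\<lambda>k. norm (up_entry m i k * up_entry n k j)) summable_on UNIV"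
    by (rule summable_on_comparison_test[OF up_product_row_abs_summable[of m i n j]])
       (simp_all add: norm_mult_ineq)
  then show "(\<lambda>k. up_entry m i k * up_entry n k j) summable_on UNIV"
    by (rule abs_summable_summable)
qed

definition up_product ::
  "('i \<Rightarrow> 'i \<Rightarrow> 'a) \<Rightarrow> ('i \<Rightarrow> 'i \<Rightarrow> 'a) \<Rightarrow> 'i \<Rightarrow> 'i \<Rightarrow> 'a::complex_banach_algebra"
  where "up_product m n i j = (\<Sum>\<^sub>\<infinity>k\<in>UNIV. m i k * n k j)"

lemma up_product_closed:
  fixes m n :: "('i::linorder, 'a::complex_banach_algebra) up_matrix"
  shows "\<not> i \<le> j \<Longrightarrow> up_product (up_entry m) (up_entry n) i j = 0"
    and "(\<lambda>x. norm (up_product (up_entry m) (up_entry n) (fst x) (snd x))) summable_on UNIV"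
    and "(\<Sum>\<^sub>\<infinity>x\<in>UNIV. norm (up_product (up_entry m) (up_entry n) (fst x) (snd x))) \<le> norm m * norm n"
proof -
  show "up_product (up_entry m) (up_entry n) i j = 0" if "\<not> i \<le> j"
  proof -
    have "up_entry m i k * up_entry n k j = 0" for k
      using that up_entry_lower[of i k m] up_entry_lower[of k j n]
      by (cases "i \<le> k") (auto dest: order_trans)
    then show ?thesis by (simp add: up_product_def)
  qed
  define T where "T x = norm (up_entry m (fst (fst x)) (snd x)) * norm (up_entry n (snd x) (snd (fst x)))" for x
  have T: "T summable_on Sigma UNIV (\<lambda>_. UNIV)" "infsum T (Sigma UNIV (\<lambda>_. UNIV)) \<le> norm m * norm n"
    using up_product_summable[of m n] by (simp_all add: T_def[abs_def])
  have row: "(\<lambda>x. \<Sum>\<^sub>\<infinity>k\<in>UNIV. T (x, k)) summable_on UNIV"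
    using summable_on_Sigma_banach[of "\<lambda>x k. T (x, k)" UNIV "\<lambda>_. UNIV"] T(1) by simp
  have tot: "(\<Sum>\<^sub>\<infinity>x\<in>UNIV. \<Sum>\<^sub>\<infinity>k\<in>UNIV. T (x, k)) \<le> norm m * norm n"
    using infsum_Sigma_banach[OF T(1)] T(2) by simp
  have le: "norm (up_product (up_entry m) (up_entry n) (fst x) (snd x)) \<le> (\<Sum>\<^sub>\<infinity>k\<in>UNIV. T (x, k))" for x
  proof -
    have "norm (up_product (up_entry m) (up_entry n) (fst x) (snd x)) \<le>
        (\<Sum>\<^sub>\<infinity>k\<in>UNIV. norm (up_entry m (fst x) k * up_entry n k (snd x)))"
      unfolding up_product_def by (rule norm_infsum_bound[OF up_product_row_summable(1)])
    also have "\<dots> \<le> (\<Sum>\<^sub>\<infinity>k\<in>UNIV. T (x, k))"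
      unfolding T_def fst_conv snd_conv
      by (rule infsum_mono[OF up_product_row_summable(1) up_product_row_abs_summable norm_mult_ineq])
    finally show ?thesis .
  qed
  show s: "(\<lambda>x. norm (up_product (up_entry m) (up_entry n) (fst x) (snd x))) summable_on UNIV"
    by (rule summable_on_comparison_test[OF row]) (simp_all add: le)
  show "(\<Sum>\<^sub>\<infinity>x\<in>UNIV. norm (up_product (up_entry m) (up_entry n) (fst x) (snd x))) \<le> norm m * norm n"
    by (rule order_trans[OF infsum_mono[OF s row le] tot])
qed

lemma up_product_assoc:
  fixes a b c :: "('i::linorder, 'a::complex_banach_algebra) up_matrix"
  shows "up_product (up_product (up_entry a) (up_entry b)) (up_entry c) i j =
    up_product (up_entry a) (up_product (up_entry b) (up_entry c)) i j"
proof -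
  define G where "G l k = up_entry a i k * up_entry b k l * up_entry c l j" for l k
  define T where "T x = norm (up_entry a (fst (fst x)) (snd x)) * norm (up_entry b (snd x) (snd (fst x)))" for x
  have "T summable_on UNIV" using up_product_summable(1)[of a b] by (simp add: T_def[abs_def])
  then have "T summable_on range (\<lambda>(l, k). ((i, l), k))" by (rule summable_on_subset_banach) simp
  then have "(T \<circ> (\<lambda>(l, k). ((i, l), k))) summable_on UNIV"
    by (subst (asm) summable_on_reindex) (auto simp: inj_on_def)
  then have "(\<lambda>x. T ((i, fst x), snd x) * norm c) summable_on UNIV"
    by (intro summable_on_cmult_left) (simp add: comp_def case_prod_unfold)
  moreover have "norm (G l k) \<le> T ((i, l), k) * norm c" for l k
  proof -
    have "norm (G l k) \<le> norm (up_entry a i k * up_entry b k l) * norm (up_entry c l j)"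
      unfolding G_def by (rule norm_mult_ineq)
    also have "\<dots> \<le> T ((i, l), k) * norm c"
      unfolding T_def by (intro mult_mono) (simp_all add: norm_mult_ineq norm_up_entry)
    finally show ?thesis .
  qed
  ultimately have "(\<lambda>x. norm (G (fst x) (snd x))) summable_on UNIV"
    by (rule summable_on_comparison_test) simp_all
  then have G: "(\<lambda>(l, k). G l k) summable_on UNIV \<times> UNIV"
    by (simp add: abs_summable_summable case_prod_unfold)
  have "up_product (up_product (up_entry a) (up_entry b)) (up_entry c) i j =
      (\<Sum>\<^sub>\<infinity>l\<in>UNIV. \<Sum>\<^sub>\<infinity>k\<in>UNIV. G l k)"
    unfolding up_product_def G_def
    by (intro infsum_cong infsum_of_bounded_linear[OF bounded_linear_mult_left, symmetric]
        up_product_row_summable(2))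
  also have "\<dots> = (\<Sum>\<^sub>\<infinity>k\<in>UNIV. \<Sum>\<^sub>\<infinity>l\<in>UNIV. G l k)"
    by (rule infsum_swap_banach[OF G])
  also have "\<dots> = up_product (up_entry a) (up_product (up_entry b) (up_entry c)) i j"
    unfolding up_product_def G_def mult.assoc
    by (intro infsum_cong infsum_of_bounded_linear[OF bounded_linear_mult_right]
        up_product_row_summable(2))
  finally show ?thesis .
qed

instantiation up_matrix :: (linorder, complex_banach_algebra) complex_banach_algebra
begin

text \<open>Only the indices \<open>k\<close> with \<open>i \<le> k \<le> j\<close> contribute to the sum.\<close>

lift_definition times_up_matrix :: "('a, 'b) up_matrix \<Rightarrow> ('a, 'b) up_matrix \<Rightarrow> ('a, 'b) up_matrix"
  is "\<lambda>m n i j. \<Sum>\<^sub>\<infinity>k\<in>UNIV. m i k * n k j"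
proof (intro conjI allI impI)
  fix m n :: "'a \<Rightarrow> 'a \<Rightarrow> 'b"
  assume "(\<forall>i j. \<not> i \<le> j \<longrightarrow> m i j = 0) \<and> (\<lambda>(i, j). norm (m i j)) summable_on UNIV"
    "(\<forall>i j. \<not> i \<le> j \<longrightarrow> n i j = 0) \<and> (\<lambda>(i, j). norm (n i j)) summable_on UNIV"
  then have mn: "up_entry (Abs_up_matrix m) = m" "up_entry (Abs_up_matrix n) = n"
    by (simp_all add: Abs_up_matrix_inverse)
  show "(\<Sum>\<^sub>\<infinity>k\<in>UNIV. m i k * n k j) = 0" if "\<not> i \<le> j" for i j
    using up_product_closed(1)[OF that, of "Abs_up_matrix m" "Abs_up_matrix n"]
    by (simp add: mn up_product_def)
  show "(\<lambda>(i, j). norm (\<Sum>\<^sub>\<infinity>k\<in>UNIV. m i k * n k j)) summable_on UNIV"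
    using up_product_closed(2)[of "Abs_up_matrix m" "Abs_up_matrix n"]
    by (simp add: mn up_product_def case_prod_unfold)
qed

lemma up_entry_times_product: "up_entry (m * n) = up_product (up_entry m) (up_entry n)"
  by (simp add: times_up_matrix.rep_eq up_product_def fun_eq_iff)

instance
proof
  fix a b c :: "('a, 'b) up_matrix" and r :: real and z :: complex
  show "a * b * c = a * (b * c)"
    by (rule up_matrix_eqI) (simp only: up_entry_times_product up_product_assoc)
  show "(a + b) * c = a * c + b * c"
    by (rule up_matrix_eqI)
       (simp add: up_entry_times_product up_product_def distrib_right infsum_add up_product_row_summable(2))
  show "a * (b + c) = a * b + a * c"
    by (rule up_matrix_eqI)
       (simp add: up_entry_times_product up_product_def distrib_left infsum_add up_product_row_summable(2))
  show C1: "(z *\<^sub>C a) * b = z *\<^sub>C (a * b)" for z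
    by (rule up_matrix_eqI)
       (simp add: up_entry_times_product up_product_def mult_scaleC_left
         infsum_of_bounded_linear[OF bounded_linear_scaleC up_product_row_summable(2)])
  show C2: "a * (z *\<^sub>C b) = z *\<^sub>C (a * b)" for z
    by (rule up_matrix_eqI)
       (simp add: up_entry_times_product up_product_def mult_scaleC_right
         infsum_of_bounded_linear[OF bounded_linear_scaleC up_product_row_summable(2)])
  show "(r *\<^sub>R a) * b = r *\<^sub>R (a * b)" "a * (r *\<^sub>R b) = r *\<^sub>R (a * b)"
    by (simp_all only: scaleR_scaleC C1 C2)
  show "norm (a * b) \<le> norm a * norm b"
    using up_product_closed(3)[of a b]
    by (simp add: norm_up_matrix[of "a * b"] up_sum_norm_def up_entry_times_product case_prod_unfold)
qed

end

section \<open>Characters\<close>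

definition characters :: "'a::complex_banach_algebra dual set"
  where "characters = {\<phi>. \<phi> \<noteq> 0 \<and>
    (\<forall>a b. cblinfun_apply \<phi> (a * b) = cblinfun_apply \<phi> a * cblinfun_apply \<phi> b)}"

text \<open>Requiring continuity is no restriction: multiplicative linear functionals are contractive.\<close>

lemma multiplicative_functional_contractive:
  fixes f :: "'a::complex_banach_algebra \<Rightarrow> complex"
  assumes add: "\<And>x y. f (x + y) = f x + f y" and sc: "\<And>c x. f (c *\<^sub>C x) = c * f x"
    and mult: "\<And>x y. f (x * y) = f x * f y"
  shows "norm (f a) \<le> norm a"
proof (rule ccontr)
  assume *: "\<not> norm (f a) \<le> norm a"
  then have fa: "f a \<noteq> 0" using norm_ge_zero[of a] by auto
  define u where "u = (1 / f a) *\<^sub>C a"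
  have fu: "f u = 1" using fa by (simp add: u_def sc)
  have nu: "norm u < 1" using * fa by (simp add: u_def norm_scaleC norm_divide)
  define p where "p n = ((*) u ^^ n) u" for n
  have "norm (p n) \<le> norm u ^ n * norm u" for n
  proof (induction n)
    case (Suc n)
    have "norm (p (Suc n)) \<le> norm u * norm (p n)" by (simp add: p_def norm_mult_ineq)
    also have "\<dots> \<le> norm u * (norm u ^ n * norm u)" by (intro mult_left_mono Suc) simp
    finally show ?case by (simp add: mult.assoc)
  qed (simp add: p_def)
  moreover have "summable (\<lambda>n. norm u ^ n * norm u)"
    using nu by (intro summable_mult2 summable_geometric) simp
  ultimately have s: "summable p" by (intro summable_comparison_test[of p]) auto
  define b where "b = suminf p"
  have "u * b = (\<Sum>n. u * p n)" unfolding b_def by (rule suminf_mult[OF s, symmetric])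
  also have "(\<lambda>n. u * p n) = (\<lambda>n. p (Suc n))" by (simp add: p_def)
  also have "(\<Sum>n. p (Suc n)) = b - u" unfolding b_def suminf_split_head[OF s] by (simp add: p_def)
  finally have "b = u * b + u" by simp
  then have "f b = f (u * b + u)" by simp
  then show False by (simp add: add mult fu)
qed

lemma characters_eq:
  "cblinfun_apply ` characters = {f :: 'a::complex_banach_algebra \<Rightarrow> complex.
    (\<forall>x y. f (x + y) = f x + f y) \<and> (\<forall>c x. f (c *\<^sub>C x) = c * f x) \<and>
    (\<forall>x y. f (x * y) = f x * f y) \<and> (\<exists>x. f x \<noteq> 0)}" (is "_ = ?R")
proof (intro equalityI subsetI)
  fix f assume "f \<in> cblinfun_apply ` (characters :: 'a dual set)"
  then obtain \<phi> :: "'a dual" where \<phi>: "f = \<phi>" "\<phi> \<in> characters" by blast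
  moreover have "\<exists>x. \<phi> x \<noteq> 0"
  proof (rule ccontr)
    assume "\<not> (\<exists>x. \<phi> x \<noteq> 0)"
    then have "\<phi> = 0" by (intro cblinfun_eqI) simp
    with \<phi>(2) show False by (simp add: characters_def)
  qed
  ultimately show "f \<in> ?R" by (simp add: characters_def cblinfun_linear)
next
  fix f :: "'a \<Rightarrow> complex" assume f: "f \<in> ?R"
  then have ap: "cblinfun_apply (CBlinfun f) = f"
    using multiplicative_functional_contractive[of f]
    by (intro CBlinfun_apply'[where K=1]) auto
  moreover have "CBlinfun f \<noteq> 0"
  proof
    assume "CBlinfun f = 0"
    then have "f x = 0" for x using ap by (metis cblinfun_simps(4))
    with f show False by blast
  qed
  ultimately have "CBlinfun f \<in> characters" using f by (simp add: characters_def)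
  with ap show "f \<in> cblinfun_apply ` characters" by (metis imageI)
qed

lemma characters_nonzero: "\<phi> \<in> characters \<Longrightarrow> \<exists>x. cblinfun_apply \<phi> x \<noteq> 0"
  using characters_eq by blast

text \<open>The extension \<open>F \<mapsto> F \<phi>\<close> of a character to the bidual.\<close>

definition char_ext :: "'a::complex_banach_algebra dual \<Rightarrow> 'a bidual dual"
  where "char_ext \<phi> = CBlinfun (\<lambda>F. Rep_bidual F \<phi>)"

lemma char_ext_apply: "char_ext \<phi> F = Rep_bidual F \<phi>"
proof -
  have 1: "norm (Rep_bidual F \<phi>) \<le> norm \<phi> * norm F" for F
    using norm_cblinfun[of "Rep_bidual F" \<phi>] by (simp add: norm_bidual.rep_eq mult.commute)
  have "cblinfun_apply (CBlinfun (\<lambda>F. Rep_bidual F \<phi>)) = (\<lambda>F. Rep_bidual F \<phi>)"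
    by (rule CBlinfun_apply'[where K="norm \<phi>"])
       (simp_all add: plus_bidual.rep_eq scaleC_bidual.rep_eq 1)
  then show ?thesis by (simp add: char_ext_def)
qed

lemma char_ext_character:
  assumes "\<phi> \<in> characters"
  shows "char_ext \<phi> \<in> characters"
proof -
  have mult: "\<phi> (a * b) = \<phi> a * \<phi> b" for a b using assms by (simp add: characters_def)
  obtain x where x: "\<phi> x \<noteq> 0" using characters_nonzero[OF assms] by blast
  have "char_ext \<phi> (Abs_bidual (eval_dual x)) = \<phi> x"
    by (simp add: char_ext_apply Abs_bidual_inverse eval_dual)
  with x have "char_ext \<phi> \<noteq> 0" by (metis cblinfun_simps(4))
  moreover have "char_ext \<phi> (F * G) = char_ext \<phi> F * char_ext \<phi> G" for F G
  proof -
    have "adjoint (lmult a) \<phi> = \<phi> a *\<^sub>C \<phi>" for a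
      by (rule cblinfun_eqI) (simp add: adjoint_apply lmult_apply mult)
    then have "arens_action (Rep_bidual G) \<phi> = Rep_bidual G \<phi> *\<^sub>C \<phi>"
      by (intro cblinfun_eqI) (simp add: arens_action_apply cblinfun_linear)
    then show ?thesis
      by (simp add: char_ext_apply times_bidual.rep_eq cblinfun_compose cblinfun_linear)
  qed
  ultimately show ?thesis by (simp add: characters_def)
qed

definition up_character ::
  "'i::linorder \<Rightarrow> 'a::complex_banach_algebra dual \<Rightarrow> ('i, 'a) up_matrix dual"
  where "up_character i0 \<phi> = CBlinfun (\<lambda>m. \<phi> (up_entry m i0 i0))"

lemma up_character_apply: "up_character i0 \<phi> m = \<phi> (up_entry m i0 i0)"
proof -
  have 1: "norm (\<phi> (up_entry m i0 i0)) \<le> norm \<phi> * norm m" for m :: "('a, 'b) up_matrix"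
    by (rule order_trans[OF norm_cblinfun mult_left_mono[OF norm_up_entry norm_ge_zero]])
  have "cblinfun_apply (CBlinfun (\<lambda>m::('a, 'b) up_matrix. \<phi> (up_entry m i0 i0))) = (\<lambda>m. \<phi> (up_entry m i0 i0))"
    by (rule CBlinfun_apply'[where K="norm \<phi>"]) (simp_all add: cblinfun_linear 1)
  then show ?thesis by (simp add: up_character_def)
qed

lemma up_entry_times_diagonal: "up_entry (m * n) i i = up_entry m i i * up_entry n i i"
proof -
  have "up_entry m i k * up_entry n k i = 0" if "k \<noteq> i" for k
    using that up_entry_lower[of i k m] up_entry_lower[of k i n] by (cases "i \<le> k") auto
  then show ?thesis
    unfolding up_entry_times_product up_product_def
    by (subst infsum_cong_neutral[of "{i}" UNIV _ "\<lambda>k. up_entry m i k * up_entry n k i"]) auto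
qed

lemma up_character_character:
  assumes "\<phi> \<in> characters"
  shows "up_character i0 \<phi> \<in> characters"
proof -
  obtain x where x: "\<phi> x \<noteq> 0" using characters_nonzero[OF assms] by blast
  let ?m = "\<lambda>i j. if i = i0 \<and> j = i0 then x else 0"
  have "(\<lambda>y. norm (?m (fst y) (snd y))) summable_on UNIV"
    by (rule summable_on_cong_neutral[THEN iffD1, OF _ _ _ summable_on_finite[of "{(i0, i0)}"]]) auto
  then have "up_entry (Abs_up_matrix ?m) = ?m"
    by (intro up_entry_Abs) auto
  then have "up_character i0 \<phi> (Abs_up_matrix ?m) = \<phi> x" by (simp add: up_character_apply)
  with x have "up_character i0 \<phi> \<noteq> 0" by (metis cblinfun_simps(4))
  with assms show ?thesis by (simp add: characters_def up_character_apply up_entry_times_diagonal)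
qed

section \<open>Left biflatness\<close>

definition tensor_mult :: "'a::complex_banach_algebra \<otimes>\<^sub>p 'a \<rightarrow>\<^sub>C 'a"
  where "tensor_mult = ptensor_lift (cbilin (*))"

lemma tensor_mult_tensor: "tensor_mult (a \<otimes> b) = a * b"
  unfolding tensor_mult_def ptensor_lift_tensor by (rule cbilin_apply[OF bounded_cbilinear_mult])

text \<open>The left action \<open>a \<cdot> (b \<otimes> c) = a b \<otimes> c\<close>.\<close>

definition tensor_lmult :: "'a::complex_banach_algebra \<Rightarrow> 'a \<otimes>\<^sub>p 'a \<rightarrow>\<^sub>C 'a \<otimes>\<^sub>p 'a"
  where "tensor_lmult a = ptensor_lift (cbilin (\<lambda>b c. (a * b) \<otimes> c))"

lemma bounded_cbilinear_tensor_lmult: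
  fixes a :: "'a::complex_banach_algebra"
  shows "bounded_cbilinear (\<lambda>b c::'a. (a * b) \<otimes> c) (norm a)"
proof (rule bounded_cbilinearI)
  fix b c :: 'a
  have "norm ((a * b) \<otimes> c) \<le> norm (a * b) * norm c" by (rule norm_tensor_le)
  also have "\<dots> \<le> norm a * norm b * norm c" by (intro mult_right_mono norm_mult_ineq norm_ge_zero)
  finally show "norm ((a * b) \<otimes> c) \<le> norm a * norm b * norm c" .
qed (simp_all add: distrib_left mult_scaleC_right tensor_add_left tensor_add_right
    tensor_scaleC_left tensor_scaleC_right)

lemma tensor_lmult_tensor: "tensor_lmult a (b \<otimes> c) = (a * b) \<otimes> c"
  unfolding tensor_lmult_def ptensor_lift_tensor
  by (rule cbilin_apply[OF bounded_cbilinear_tensor_lmult])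

lemma norm_tensor_lmult: "norm (tensor_lmult a) \<le> norm a"
  unfolding tensor_lmult_def norm_ptensor_lift by (rule norm_cbilin[OF bounded_cbilinear_tensor_lmult])

text \<open>
  The left action on the bidual of the tensor product: the right action \<open>(f \<cdot> a)(x) = f (a \<cdot> x)\<close>
  on its dual is \<open>adjoint (tensor_lmult a)\<close>, and \<open>(a \<cdot> M)(f) = M (f \<cdot> a)\<close>.
\<close>

definition tensor_bidual_lmult ::
  "'a::complex_banach_algebra \<Rightarrow> ('a \<otimes>\<^sub>p 'a) dual dual \<rightarrow>\<^sub>C ('a \<otimes>\<^sub>p 'a) dual dual"
  where "tensor_bidual_lmult a = adjoint (adjoint (tensor_lmult a))"

lemma tensor_bidual_lmult_apply: "tensor_bidual_lmult a M f = M (adjoint (tensor_lmult a) f)"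
  by (simp add: tensor_bidual_lmult_def adjoint_apply)

definition left_biflat :: "'a::complex_banach_algebra dual \<Rightarrow> bool"
  where "left_biflat \<phi> \<longleftrightarrow>
    (\<exists>\<rho> :: 'a \<rightarrow>\<^sub>C ('a \<otimes>\<^sub>p 'a) dual dual.
      (\<forall>a b. cblinfun_apply \<rho> (a * b) = \<phi> b *\<^sub>C cblinfun_apply \<rho> a \<and>
             cblinfun_apply \<rho> (a * b) = tensor_bidual_lmult a (cblinfun_apply \<rho> b)) \<and>
      (\<forall>a. char_ext \<phi> (Abs_bidual (adjoint (adjoint tensor_mult) (cblinfun_apply \<rho> a))) = \<phi> a))"

end

theory Submission
  imports Defs
begin

text \<open>
  In an algebra with a left identity, left \<open>\<phi>\<close>-biflatness is the existence of a functional \<open>n\<close>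
  on the dual with \<open>n \<phi> = 1\<close> and \<open>a \<cdot> n = \<phi> a n\<close> for all \<open>a\<close>, that is, left
  \<open>\<phi>\<close>-amenability (\<open>left_biflat_iff_left_amenable\<close>): for a left identity \<open>e\<close>, both
  \<open>a \<cdot> \<rho> e\<close> and \<open>\<phi> a \<rho> e\<close> are \<open>\<rho> a\<close>, so the image of \<open>\<rho> e\<close> under the second adjoint of
  the multiplication map is such an \<open>n\<close>; conversely \<open>\<rho> a = \<phi> a (n \<otimes> y)\<close> works for any
  \<open>y\<close> with \<open>\<phi> y = 1\<close>. The point of the reformulation is that left amenability passes along
  surjective homomorphisms (\<open>left_amenable_transport\<close>) and back and forth between an algebra
  and its bidual (\<open>left_amenable_bidual_iff\<close>). Since a left identity of the algebra is also one
  of the bidual, this settles the case of one index, where the matrix algebra is a copy of \<open>A\<close>.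

  If there is an index \<open>i < i\<^sub>0\<close>, let \<open>X\<close> be the matrix with the single entry \<open>e\<close> at
  \<open>(i, i\<^sub>0)\<close>, and \<open>D\<close> the one with the single entry \<open>e\<close> at \<open>(i, i)\<close>. The character \<open>\<psi>\<close>
  vanishes at \<open>X = D X\<close>, and therefore \<open>\<rho> X = \<psi> X \<rho> D = 0\<close>. On the other hand
  \<open>\<rho> X = X \<cdot> \<rho> E\<close> whenever \<open>\<psi> E = 1\<close>, and multiplication by \<open>X\<close> moves the corner entry
  \<open>(i\<^sub>0, i\<^sub>0)\<close> to the place \<open>(i, i\<^sub>0)\<close> without loss, so that \<open>X \<cdot> \<rho> E\<close> still determines the
  value \<open>\<psi> E = 1\<close> and cannot be \<open>0\<close> (\<open>left_biflat_obstruction\<close>).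
\<close>

section \<open>Left amenability at a character\<close>

text \<open>
  Left \<open>\<phi>\<close>-amenability: a normalised element \<open>n\<close> of the bidual with \<open>a \<cdot> n = \<phi> a n\<close>, where
  \<open>(a \<cdot> n)(f) = n (f \<cdot> a)\<close> and \<open>f \<cdot> a\<close> is \<open>adjoint (lmult a) f\<close>.
\<close>

definition left_amenable :: "'a::complex_banach_algebra dual \<Rightarrow> bool"
  where "left_amenable \<phi> \<longleftrightarrow> (\<exists>n :: 'a dual dual. cblinfun_apply n \<phi> = 1 \<and>
    (\<forall>a f. cblinfun_apply n (adjoint (lmult a) f) = \<phi> a * n f))"

lemma character_mult: "\<phi> \<in> characters \<Longrightarrow> cblinfun_apply \<phi> (a * b) = \<phi> a * \<phi> b"
  by (simp add: characters_def)

lemma character_left_identity: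
  fixes \<phi> :: "'a::complex_banach_algebra dual"
  assumes "\<phi> \<in> characters" and "\<And>a::'a. e * a = a"
  shows "cblinfun_apply \<phi> e = 1"
proof -
  obtain x where x: "\<phi> x \<noteq> 0" using characters_nonzero[OF assms(1)] by blast
  have "\<phi> e * \<phi> x = \<phi> x" using character_mult[OF assms(1), of e x] by (simp add: assms(2))
  with x show ?thesis by simp
qed

lemma tensor_mult_lmult: "tensor_mult (tensor_lmult a u) = a * tensor_mult u"
proof -
  have "tensor_mult o\<^sub>C tensor_lmult a = lmult a o\<^sub>C tensor_mult"
    by (rule ptensor_eqI)
       (simp add: cblinfun_compose tensor_lmult_tensor tensor_mult_tensor lmult_apply mult.assoc)
  then show ?thesis by (metis cblinfun_compose lmult_apply)
qed

lemma adjoint_tensor_lmult_mult: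
  "adjoint (tensor_lmult a) (adjoint tensor_mult f) = adjoint tensor_mult (adjoint (lmult a) f)"
  by (rule cblinfun_eqI) (simp add: adjoint_apply tensor_mult_lmult lmult_apply)

lemma char_ext_adjoint_tensor_mult:
  "char_ext \<phi> (Abs_bidual (adjoint (adjoint tensor_mult) M)) = M (adjoint tensor_mult \<phi>)"
  by (simp add: char_ext_apply Abs_bidual_inverse adjoint_apply)

lemma left_amenable_if_left_biflat:
  fixes \<phi> :: "'a::complex_banach_algebra dual"
  assumes \<phi>: "\<phi> \<in> characters" and e: "\<And>a::'a. e * a = a" and "left_biflat \<phi>"
  shows "left_amenable \<phi>"
proof -
  obtain \<rho> :: "'a \<rightarrow>\<^sub>C ('a \<otimes>\<^sub>p 'a) dual dual" where
    \<rho>1: "\<And>a b. \<rho> (a * b) = \<phi> b *\<^sub>C \<rho> a" and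
    \<rho>2: "\<And>a b. \<rho> (a * b) = tensor_bidual_lmult a (\<rho> b)" and
    \<rho>3: "\<And>a. char_ext \<phi> (Abs_bidual (adjoint (adjoint tensor_mult) (\<rho> a))) = \<phi> a"
    using assms(3) unfolding left_biflat_def by blast
  have \<phi>e: "\<phi> e = 1" by (rule character_left_identity[OF \<phi> e])
  have inv: "\<rho> e (adjoint (tensor_lmult a) g) = \<phi> a * \<rho> e g" for a g
  proof -
    have "tensor_bidual_lmult a (\<rho> e) = \<rho> a" using \<rho>1[of a e] \<rho>2[of a e] by (simp add: \<phi>e)
    also have "\<dots> = \<phi> a *\<^sub>C \<rho> e" using \<rho>1[of e a] by (simp add: e)
    finally show ?thesis using tensor_bidual_lmult_apply[of a "\<rho> e" g] by simp
  qed
  define n where "n = adjoint (adjoint tensor_mult) (\<rho> e)"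
  have n: "n f = \<rho> e (adjoint tensor_mult f)" for f by (simp add: n_def adjoint_apply)
  have "n \<phi> = 1" using \<rho>3[of e] by (simp add: n char_ext_adjoint_tensor_mult \<phi>e)
  moreover have "n (adjoint (lmult a) f) = \<phi> a * n f" for a f
    by (simp add: n inv flip: adjoint_tensor_lmult_mult)
  ultimately show ?thesis unfolding left_amenable_def by blast
qed

lemma left_biflat_if_left_amenable:
  fixes \<phi> :: "'a::complex_banach_algebra dual"
  assumes \<phi>: "\<phi> \<in> characters" and "left_amenable \<phi>"
  shows "left_biflat \<phi>"
proof -
  obtain n :: "'a dual dual" where n1: "n \<phi> = 1"
    and n2: "\<And>a f. n (adjoint (lmult a) f) = \<phi> a * n f"
    using assms(2) unfolding left_amenable_def by blast
  obtain x where x: "\<phi> x \<noteq> 0" using characters_nonzero[OF \<phi>] by blast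
  define y where "y = (1 / \<phi> x) *\<^sub>C x"
  have y: "\<phi> y = 1" using x by (simp add: y_def cblinfun_linear)
  define \<tau> where "\<tau> = CBlinfun (\<lambda>a::'a. a \<otimes> y)"
  have \<tau>: "\<tau> a = a \<otimes> y" for a
  proof -
    have "cblinfun_apply \<tau> = (\<lambda>a. a \<otimes> y)"
      unfolding \<tau>_def
      by (rule CBlinfun_apply'[where K="norm y"])
         (simp_all add: tensor_add_left tensor_scaleC_left norm_tensor_le mult.commute)
    then show ?thesis by simp
  qed
  \<comment> \<open>\<open>M\<close> is the element \<open>n \<otimes> y\<close> of the bidual of the tensor product.\<close>
  define M where "M = adjoint (adjoint \<tau>) n"
  have M: "M g = n (adjoint \<tau> g)" for g by (simp add: M_def adjoint_apply)
  have "adjoint \<tau> (adjoint (tensor_lmult a) g) = adjoint (lmult a) (adjoint \<tau> g)" for a g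
    by (rule cblinfun_eqI) (simp add: adjoint_apply \<tau> tensor_lmult_tensor lmult_apply)
  then have M_inv: "tensor_bidual_lmult a M = \<phi> a *\<^sub>C M" for a
    by (intro cblinfun_eqI) (simp add: tensor_bidual_lmult_apply M n2)
  have "adjoint \<tau> (adjoint tensor_mult \<phi>) = \<phi>"
    by (rule cblinfun_eqI) (simp add: adjoint_apply \<tau> tensor_mult_tensor character_mult[OF \<phi>] y)
  then have M_1: "M (adjoint tensor_mult \<phi>) = 1" by (simp add: M n1)
  define \<rho> where "\<rho> = CBlinfun (\<lambda>a. \<phi> a *\<^sub>C M)"
  have \<rho>: "\<rho> a = \<phi> a *\<^sub>C M" for a
  proof -
    have "norm (\<phi> a *\<^sub>C M) \<le> (norm \<phi> * norm M) * norm a" for a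
      using mult_right_mono[OF norm_cblinfun[of \<phi> a], of "norm M"]
      by (simp add: norm_scaleC ac_simps)
    then have "cblinfun_apply \<rho> = (\<lambda>a. \<phi> a *\<^sub>C M)"
      unfolding \<rho>_def
      by (intro CBlinfun_apply'[where K="norm \<phi> * norm M"])
         (simp_all add: cblinfun_linear scaleC_add_left scaleC_scaleC)
    then show ?thesis by simp
  qed
  have "\<rho> (a * b) = \<phi> b *\<^sub>C \<rho> a \<and> \<rho> (a * b) = tensor_bidual_lmult a (\<rho> b)" for a b
    by (simp add: \<rho> character_mult[OF \<phi>] cblinfun_linear M_inv scaleC_scaleC mult.commute)
  moreover have "char_ext \<phi> (Abs_bidual (adjoint (adjoint tensor_mult) (\<rho> a))) = \<phi> a" for a
    unfolding char_ext_adjoint_tensor_mult by (simp add: \<rho> M_1)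
  ultimately show ?thesis unfolding left_biflat_def by blast
qed

lemma left_biflat_iff_left_amenable:
  fixes \<phi> :: "'a::complex_banach_algebra dual"
  assumes "\<phi> \<in> characters" and "\<And>a::'a. e * a = a"
  shows "left_biflat \<phi> \<longleftrightarrow> left_amenable \<phi>"
  using left_amenable_if_left_biflat[OF assms] left_biflat_if_left_amenable[OF assms(1)] by blast

lemma left_amenable_transport:
  fixes T :: "'a::complex_banach_algebra \<rightarrow>\<^sub>C 'b::complex_banach_algebra"
    and \<psi> :: "'a dual" and \<phi> :: "'b dual"
  assumes mult: "\<And>x y. T (x * y) = T x * T y" and surj: "\<And>b. \<exists>a. b = T a"
    and \<phi>: "\<And>x. \<psi> x = \<phi> (T x)" and "left_amenable \<psi>"
  shows "left_amenable \<phi>"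
proof -
  obtain n :: "'a dual dual" where n1: "n \<psi> = 1"
    and n2: "\<And>a f. n (adjoint (lmult a) f) = \<psi> a * n f"
    using assms(4) unfolding left_amenable_def by blast
  define m where "m = adjoint (adjoint T) n"
  have m: "m f = n (adjoint T f)" for f by (simp add: m_def adjoint_apply)
  have "adjoint T \<phi> = \<psi>" by (rule cblinfun_eqI) (simp add: adjoint_apply \<phi>)
  then have "m \<phi> = 1" by (simp add: m n1)
  moreover have "m (adjoint (lmult b) f) = \<phi> b * m f" for b f
  proof -
    obtain a where a: "b = T a" using surj by blast
    have "adjoint T (adjoint (lmult b) f) = adjoint (lmult a) (adjoint T f)"
      by (rule cblinfun_eqI) (simp add: adjoint_apply lmult_apply a mult)
    then show ?thesis by (simp add: m n2 \<phi> a)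
  qed
  ultimately show ?thesis unfolding left_amenable_def by blast
qed

section \<open>Passing to the bidual\<close>

text \<open>The canonical embedding of a Banach algebra into its bidual.\<close>

definition bidual_embed :: "'a::complex_banach_algebra \<Rightarrow> 'a bidual"
  where "bidual_embed a = Abs_bidual (eval_dual a)"

lemma Rep_bidual_embed: "Rep_bidual (bidual_embed a) f = f a"
  by (simp add: bidual_embed_def Abs_bidual_inverse eval_dual)

lemma Rep_bidual_embed_times: "Rep_bidual (bidual_embed a * G) f = Rep_bidual G (adjoint (lmult a) f)"
  by (simp add: times_bidual.rep_eq cblinfun_compose Rep_bidual_embed arens_action_apply)

lemma bidual_eqI: "(\<And>f. Rep_bidual F f = Rep_bidual G f) \<Longrightarrow> F = G"
  by (simp add: cblinfun_eqI flip: Rep_bidual_inject)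

lemma bidual_embed_mult: "bidual_embed (a * b) = bidual_embed a * bidual_embed b"
  by (rule bidual_eqI)
     (simp only: Rep_bidual_embed_times Rep_bidual_embed adjoint_apply lmult_apply)

lemma bidual_embed_left_identity:
  assumes "\<And>a. e * a = a"
  shows "bidual_embed e * G = G"
proof (rule bidual_eqI)
  fix f
  have "adjoint (lmult e) f = f"
    by (rule cblinfun_eqI) (simp add: adjoint_apply lmult_apply assms)
  then show "Rep_bidual (bidual_embed e * G) f = Rep_bidual G f"
    by (simp add: Rep_bidual_embed_times)
qed

lemma left_amenable_if_bidual:
  fixes \<phi> :: "'a::complex_banach_algebra dual"
  assumes "left_amenable (char_ext \<phi>)"
  shows "left_amenable \<phi>"
proof -
  obtain N :: "'a bidual dual dual" where N1: "N (char_ext \<phi>) = 1"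
    and N2: "\<And>F g. N (adjoint (lmult F) g) = char_ext \<phi> F * N g"
    using assms unfolding left_amenable_def by blast
  \<comment> \<open>\<open>char_ext\<close> makes sense for every functional and embeds the dual in its bidual;
    \<open>n\<close> is the restriction of \<open>N\<close> to the dual.\<close>
  define n where "n = CBlinfun (\<lambda>f::'a dual. N (char_ext f))"
  have lin: "char_ext (f + g) = char_ext f + char_ext g" "char_ext (c *\<^sub>C f) = c *\<^sub>C char_ext f"
    for f g :: "'a dual" and c
    by (rule cblinfun_eqI, simp add: char_ext_apply cblinfun_linear)+
  have bd: "norm (char_ext f) \<le> norm f" for f :: "'a dual"
    by (rule norm_cblinfun_bound)
       (use norm_cblinfun[of "Rep_bidual _" f] in
         \<open>simp_all add: char_ext_apply norm_bidual.rep_eq mult.commute\<close>)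
  have n: "n f = N (char_ext f)" for f
  proof -
    have "norm (N (char_ext f)) \<le> norm N * norm f" for f
      by (rule order_trans[OF norm_cblinfun mult_left_mono[OF bd norm_ge_zero]])
    then have "cblinfun_apply n = (\<lambda>f. N (char_ext f))"
      unfolding n_def
      by (intro CBlinfun_apply'[where K="norm N"]) (simp_all add: lin cblinfun_linear)
    then show ?thesis by simp
  qed
  have "n (adjoint (lmult a) f) = \<phi> a * n f" for a f
  proof -
    have "char_ext (adjoint (lmult a) f) = adjoint (lmult (bidual_embed a)) (char_ext f)"
      by (rule cblinfun_eqI)
         (simp add: char_ext_apply adjoint_apply lmult_apply Rep_bidual_embed_times)
    then show ?thesis by (simp add: n N2 char_ext_apply Rep_bidual_embed)
  qed
  moreover have "n \<phi> = 1" by (simp add: n N1)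
  ultimately show ?thesis unfolding left_amenable_def by blast
qed

lemma left_amenable_bidual:
  fixes \<phi> :: "'a::complex_banach_algebra dual"
  assumes "left_amenable \<phi>"
  shows "left_amenable (char_ext \<phi>)"
proof -
  obtain n :: "'a dual dual" where n1: "n \<phi> = 1"
    and n2: "\<And>a f. n (adjoint (lmult a) f) = \<phi> a * n f"
    using assms unfolding left_amenable_def by blast
  define n' where "n' = Abs_bidual n"
  have n': "Rep_bidual n' = n" by (simp add: n'_def Abs_bidual_inverse)
  have "arens_action n f = n f *\<^sub>C \<phi>" for f
    by (rule cblinfun_eqI) (simp add: arens_action_apply n2)
  then have mult: "F * n' = char_ext \<phi> F *\<^sub>C n'" for F
    by (intro bidual_eqI)
       (simp add: times_bidual.rep_eq scaleC_bidual.rep_eq cblinfun_compose n' char_ext_apply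
         cblinfun_linear)
  have "eval_dual n' (adjoint (lmult F) g) = char_ext \<phi> F * eval_dual n' g" for F g
    by (simp add: eval_dual adjoint_apply lmult_apply mult cblinfun_linear)
  moreover have "eval_dual n' (char_ext \<phi>) = 1"
    by (simp add: eval_dual char_ext_apply n' n1)
  ultimately show ?thesis unfolding left_amenable_def by blast
qed

lemma left_amenable_bidual_iff: "left_amenable (char_ext \<phi>) \<longleftrightarrow> left_amenable \<phi>"
  using left_amenable_if_bidual left_amenable_bidual by blast

section \<open>An obstruction to left biflatness\<close>

text \<open>
  The hypothesis on \<open>f\<close> reads \<open>f \<cdot> X = \<phi>\<close>. By \<open>\<rho> X = \<phi> X \<rho> D = 0\<close>, the element
  \<open>X \<cdot> \<rho> E = \<rho> X\<close> vanishes, but at \<open>f \<circ> \<pi>\<close> its value is that of \<open>\<rho> E\<close> at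
  \<open>\<phi> \<circ> \<pi>\<close>, which is \<open>\<phi> E\<close>.
\<close>

lemma left_biflat_obstruction:
  fixes \<phi> f :: "'a::complex_banach_algebra dual"
  assumes \<phi>: "\<phi> \<in> characters" and DX: "D * X = X" and \<phi>X: "\<phi> X = 0"
    and f: "\<And>c. f (X * c) = \<phi> c"
  shows "\<not> left_biflat \<phi>"
proof
  assume "left_biflat \<phi>"
  then obtain \<rho> :: "'a \<rightarrow>\<^sub>C ('a \<otimes>\<^sub>p 'a) dual dual" where
    \<rho>1: "\<And>a b. \<rho> (a * b) = \<phi> b *\<^sub>C \<rho> a" and
    \<rho>2: "\<And>a b. \<rho> (a * b) = tensor_bidual_lmult a (\<rho> b)" and
    \<rho>3: "\<And>a. char_ext \<phi> (Abs_bidual (adjoint (adjoint tensor_mult) (\<rho> a))) = \<phi> a"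
    unfolding left_biflat_def by blast
  obtain E where E: "\<phi> E \<noteq> 0" using characters_nonzero[OF \<phi>] by blast
  have "\<rho> X = 0" using \<rho>1[of D X] by (simp add: DX \<phi>X)
  then have 0: "tensor_bidual_lmult X (\<rho> E) = 0" using \<rho>1[of X E] \<rho>2[of X E] by simp
  have "adjoint (lmult X) f = \<phi>"
    by (rule cblinfun_eqI) (simp add: adjoint_apply lmult_apply f)
  then have "\<phi> E = tensor_bidual_lmult X (\<rho> E) (adjoint tensor_mult f)"
    using \<rho>3[of E]
    by (simp add: tensor_bidual_lmult_apply adjoint_tensor_lmult_mult char_ext_adjoint_tensor_mult)
  with 0 E show False by simp
qed

section \<open>Matrices with a single entry\<close>

text \<open>The matrix whose only entry is \<open>a\<close> at \<open>(i, j)\<close>; it is upper triangular if \<open>i \<le> j\<close>.\<close>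

definition up_single :: "'i::linorder \<Rightarrow> 'i \<Rightarrow> 'a::complex_banach_algebra \<Rightarrow> ('i, 'a) up_matrix"
  where "up_single i j a = Abs_up_matrix (\<lambda>k l. if k = i \<and> l = j then a else 0)"

lemma up_entry_single:
  assumes "i \<le> j"
  shows "up_entry (up_single i j a) k l = (if k = i \<and> l = j then a else 0)"
proof -
  let ?m = "\<lambda>k l. if k = i \<and> l = j then a else 0"
  have "(\<lambda>x. norm (?m (fst x) (snd x))) summable_on UNIV"
    by (rule summable_on_cong_neutral[THEN iffD1, OF _ _ _ summable_on_finite[of "{(i, j)}"]]) auto
  then have "up_entry (up_single i j a) = ?m"
    unfolding up_single_def using assms by (intro up_entry_Abs) auto
  then show ?thesis by simp
qed

lemma norm_up_single:
  assumes "i \<le> j"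
  shows "norm (up_single i j a) = norm a"
proof -
  have "norm (up_single i j a) =
      (\<Sum>\<^sub>\<infinity>x\<in>UNIV. norm (up_entry (up_single i j a) (fst x) (snd x)))"
    by (simp add: norm_up_matrix up_sum_norm_def case_prod_unfold)
  also have "\<dots> = (\<Sum>\<^sub>\<infinity>x\<in>{(i, j)}. norm (up_entry (up_single i j a) (fst x) (snd x)))"
    by (rule infsum_cong_neutral) (auto simp: up_entry_single[OF assms])
  also have "\<dots> = norm a" by (simp add: up_entry_single[OF assms])
  finally show ?thesis .
qed

lemma up_entry_single_times:
  assumes "i \<le> j"
  shows "up_entry (up_single i j a * m) k l = (if k = i then a * up_entry m j l else 0)"
proof -
  have "up_entry (up_single i j a * m) k l =
      (\<Sum>\<^sub>\<infinity>r\<in>UNIV. up_entry (up_single i j a) k r * up_entry m r l)"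
    by (simp add: up_entry_times_product up_product_def)
  also have "\<dots> = (\<Sum>\<^sub>\<infinity>r\<in>{j}. up_entry (up_single i j a) k r * up_entry m r l)"
    by (rule infsum_cong_neutral) (auto simp: up_entry_single[OF assms])
  also have "\<dots> = (if k = i then a * up_entry m j l else 0)"
    by (simp add: up_entry_single[OF assms])
  finally show ?thesis .
qed

lemma up_entry_cblinfun:
  "\<exists>P :: ('i::linorder, 'a::complex_banach_algebra) up_matrix \<rightarrow>\<^sub>C 'a. \<forall>m. P m = up_entry m i j"
proof -
  have "cblinfun_apply (CBlinfun (\<lambda>m::('i, 'a) up_matrix. up_entry m i j)) = (\<lambda>m. up_entry m i j)"
    by (rule CBlinfun_apply'[where K=1]) (simp_all add: norm_up_entry)
  then show ?thesis by metis
qed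

lemma up_single_cblinfun:
  assumes "i \<le> j"
  shows "\<exists>J :: 'a::complex_banach_algebra \<rightarrow>\<^sub>C ('i::linorder, 'a) up_matrix. \<forall>a. J a = up_single i j a"
proof -
  have "cblinfun_apply (CBlinfun (up_single i j :: 'a \<Rightarrow> ('i, 'a) up_matrix)) = up_single i j"
    by (rule CBlinfun_apply'[where K=1])
       (auto intro!: up_matrix_eqI simp: up_entry_single[OF assms] norm_up_single[OF assms])
  then show ?thesis by metis
qed

section \<open>Left biflatness of the bidual of the matrix algebra\<close>

lemma not_left_biflat_up_bidual:
  fixes \<phi> :: "'a::complex_banach_algebra dual" and i i0 :: "'i::linorder"
  assumes i: "i < i0" and e: "\<And>a::'a. e * a = a" and \<phi>: "\<phi> \<in> characters"
  shows "\<not> left_biflat (char_ext (up_character i0 \<phi>) :: ('i, 'a) up_matrix bidual dual)"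
proof -
  have le: "i \<le> i0" using i by simp
  obtain P :: "('i, 'a) up_matrix \<rightarrow>\<^sub>C 'a" where P: "\<And>m. P m = up_entry m i i0"
    using up_entry_cblinfun[of i i0] by blast
  define f where "f = \<phi> o\<^sub>C P"
  define X where "X = up_single i i0 e"
  define D where "D = up_single i i e"
  have DX: "D * X = X"
    by (rule up_matrix_eqI)
       (auto simp: D_def X_def up_entry_single_times up_entry_single[OF le] e)
  have fX: "adjoint (lmult X) f = up_character i0 \<phi>"
    by (rule cblinfun_eqI)
       (simp add: adjoint_apply lmult_apply f_def cblinfun_compose P X_def
         up_entry_single_times[OF le] e up_character_apply)
  have \<psi>X: "up_character i0 \<phi> X = 0"
    using i by (simp add: up_character_apply X_def up_entry_single[OF le] cblinfun_linear)
  show ?thesis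
  proof (rule left_biflat_obstruction)
    show "char_ext (up_character i0 \<phi>) \<in> characters"
      by (intro char_ext_character up_character_character \<phi>)
    show "bidual_embed D * bidual_embed X = bidual_embed X"
      by (simp add: DX flip: bidual_embed_mult)
    show "char_ext (up_character i0 \<phi>) (bidual_embed X) = 0"
      by (simp add: char_ext_apply Rep_bidual_embed \<psi>X)
    show "char_ext f (bidual_embed X * G) = char_ext (up_character i0 \<phi>) G" for G
      by (simp add: char_ext_apply Rep_bidual_embed_times fX)
  qed
qed

lemma left_biflat_up_bidual_singleton:
  fixes \<phi> :: "'a::complex_banach_algebra dual" and i0 :: "'i::linorder"
  assumes single: "\<And>i. i = i0" and e: "\<And>a::'a. e * a = a" and \<phi>: "\<phi> \<in> characters"
  shows "left_biflat (char_ext (up_character i0 \<phi>) :: ('i, 'a) up_matrix bidual dual)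
    \<longleftrightarrow> left_biflat \<phi>"
proof -
  let ?\<psi> = "up_character i0 \<phi> :: ('i, 'a) up_matrix dual"
  obtain P :: "('i, 'a) up_matrix \<rightarrow>\<^sub>C 'a" where P: "\<And>m. P m = up_entry m i0 i0"
    using up_entry_cblinfun[of i0 i0] by blast
  obtain J :: "'a \<rightarrow>\<^sub>C ('i, 'a) up_matrix" where J: "\<And>a. J a = up_single i0 i0 a"
    using up_single_cblinfun[of i0 i0] by blast
  have eqI: "m = n" if "up_entry m i0 i0 = up_entry n i0 i0" for m n :: "('i, 'a) up_matrix"
    by (rule up_matrix_eqI) (metis single that)
  have PJ: "a = P (J a)" for a by (simp add: P J up_entry_single)
  have JP: "m = J (P m)" for m by (rule eqI) (simp add: P J up_entry_single)
  have e': "up_single i0 i0 e * m = m" for m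
    by (rule eqI) (simp add: up_entry_single_times e)
  have "left_amenable ?\<psi> \<longleftrightarrow> left_amenable \<phi>"
  proof
    assume "left_amenable ?\<psi>"
    then show "left_amenable \<phi>"
    proof (rule left_amenable_transport[of P, rotated 3])
      show "P (m * n) = P m * P n" for m n by (simp add: P up_entry_times_diagonal)
      show "\<exists>m. a = P m" for a using PJ by blast
      show "?\<psi> m = \<phi> (P m)" for m by (simp add: P up_character_apply)
    qed
  next
    assume "left_amenable \<phi>"
    then show "left_amenable ?\<psi>"
    proof (rule left_amenable_transport[of J, rotated 3])
      show "J (a * b) = J a * J b" for a b
        by (rule eqI) (simp add: J up_entry_single up_entry_times_diagonal)
      show "\<exists>a. m = J a" for m using JP by blast
      show "\<phi> a = ?\<psi> (J a)" for a by (simp add: J up_character_apply up_entry_single)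
    qed
  qed
  moreover have "left_biflat (char_ext ?\<psi>) \<longleftrightarrow> left_amenable (char_ext ?\<psi>)"
    by (rule left_biflat_iff_left_amenable[OF _ bidual_embed_left_identity[OF e']])
       (intro char_ext_character up_character_character \<phi>)
  ultimately show ?thesis
    by (simp add: left_amenable_bidual_iff left_biflat_iff_left_amenable[OF \<phi> e])
qed

theorem proposition2p4:
  fixes i0 :: "'i::linorder" and \<phi> :: "'a::complex_banach_algebra dual"
  assumes "\<And>i. i \<le> i0"
    and "\<exists>e::'a. \<forall>a. e * a = a"
    and "\<phi> \<in> characters"
  shows "left_biflat (char_ext (up_character i0 \<phi>) :: ('i, 'a) up_matrix bidual dual) \<longleftrightarrow>
    CARD('i) = 1 \<and> left_biflat \<phi>"
proof -
  obtain e :: 'a where e: "\<And>a. e * a = a" using assms(2) by blast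
  show ?thesis
  proof (cases "\<forall>i. i = i0")
    case True
    then have "(UNIV :: 'i set) = {i0}" by blast
    then have "CARD('i) = 1" unfolding card_1_singleton_iff One_nat_def by blast
    with left_biflat_up_bidual_singleton[OF True[rule_format] e assms(3)] show ?thesis by simp
  next
    case False
    then obtain i where "i \<noteq> i0" by blast
    then have "i < i0" using assms(1)[of i] by simp
    moreover have "CARD('i) \<noteq> 1" using \<open>i \<noteq> i0\<close> by (metis UNIV_I card_1_singletonE singletonD)
    ultimately show ?thesis using not_left_biflat_up_bidual[OF _ e assms(3)] by blast
  qed
qed

end
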